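(* Consider the exponential model and suppose that $\underline{\alpha}=\underline{\beta}=0$. Then the shape function $g$ satisfies $$g(s,t)=s\,E\left[\frac{1}{a}\right]+t\,E\left[\frac{1}{b}\right]\quad\text{for all } s,t>0$$ (an identity in $[0,\infty]$).
   Context: $\mathbb{N}=\{1,2,\dots\}$, $\mathbb{Z}_+=\{0,1,2,\dots\}$, $\mathbb{R}_+=[0,\infty)$; $\lfloor x\rfloor$ is the integer part; $x\vee y=\max\{x,y\}$. Environment. Let $\mathbf{a}=(a_n)_{n\in\mathbb{N}}$ and $\mathbf{b}=(b_n)_{n\in\mathbb{N}}$ be stationary random sequences in $(0,\infty)$, and let $\mu$ be the distribution of $(\mathbf{a},\mathbf{b})$. For $k\in\mathbb{Z}_+$ let $\tau_k$ be the shift $(c_n)_{n\in\mathbb{N}}\mapsto(c_{n+k})_{n\in\mathbb{N}}$. It is assumed that $\mu$ is (stationary and) ergodic under the map $\tau_k\times\tau_l:(\mathbf{a},\mathbf{b})\mapsto(\tau_k\mathbf{a},\tau_l\mathbf{b})$ for each $k,l\in\mathbb{N}$. Write $E$ for expectation under $\mu$, $a=a_1$, $b=b_1$, and let $\alpha,\beta$ be the distributions of $a,b$. For a Borel measure $\eta$ on $\mathbb{R}$, $\underline{\eta}$ is the left endpoint of the support of $\eta$. Exponential model. Given $(\mathbf{a},\mathbf{b})$, the weights $W(i,j)$, $i,j\in\mathbb{N}$, are (conditionally) independent and $W(i,j)$ is exponentially distributed with rate $a_i+b_j$. Their conditional joint law (a product measure on $\mathbb{R}_+^{\mathbb{N}^2}$)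 is $\mathbf{P}_{\mathbf{a},\mathbf{b}}$, and $\mathbb{P}(\cdot)=\int\mathbf{P}_{\mathbf{a},\mathbf{b}}(\cdot)\,\mu(d\mathbf{a},d\mathbf{b})$ is the joint law of the weights. Last-passage times. $G(i,j)=G(i-1,j)\vee G(i,j-1)+W(i,j)$ for $i,j\in\mathbb{N}$, with $G(i,0)=G(0,j)=0$. Equivalently, $G(m,n)$ is the maximum over all directed paths $\pi$ from $(1,1)$ to $(m,n)$ with steps $(1,0)$ or $(0,1)$ of $\sum_{(i,j)\in\pi}W(i,j)$. Shape function. There is a deterministic function $g:(0,\infty)^2\to[0,\infty]$, called the shape function, such that $\mathbb{P}$-a.s. $\lim_{n\to\infty}G(\lfloor ns\rfloor,\lfloor nt\rfloor)/n=g(s,t)$ for all $s,t>0$. *)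

theory Defs
  imports "HOL-Probability.Probability"
begin

(* Indexing convention: the index set {1,2,...} of the environment and of the weights is
   encoded as nat starting at 0, so c n stands for c_{n+1} and w (i, j) for W(i+1, j+1).
   The last-passage times G keep their original indices, with boundary values at index 0. *)

definition seq_space :: "(nat \<Rightarrow> real) measure" where
  "seq_space = (\<Pi>\<^sub>M n\<in>UNIV. restrict_space borel {0<..})"

definition env_space :: "((nat \<Rightarrow> real) \<times> (nat \<Rightarrow> real)) measure" where
  "env_space = seq_space \<Otimes>\<^sub>M seq_space"

definition shift :: "nat \<Rightarrow> (nat \<Rightarrow> real) \<Rightarrow> nat \<Rightarrow> real" where
  "shift k c = (\<lambda>n. c (n + k))"

definition stationary_under :: "'a measure \<Rightarrow> ('a \<Rightarrow> 'a) \<Rightarrow> bool" where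
  "stationary_under M T \<longleftrightarrow> T \<in> M \<rightarrow>\<^sub>M M \<and> distr M M T = M"

definition ergodic_under :: "'a measure \<Rightarrow> ('a \<Rightarrow> 'a) \<Rightarrow> bool" where
  "ergodic_under M T \<longleftrightarrow>
     (\<forall>A\<in>sets M. T -` A \<inter> space M = A \<longrightarrow> emeasure M A = 0 \<or> emeasure M A = 1)"

definition environment :: "((nat \<Rightarrow> real) \<times> (nat \<Rightarrow> real)) measure \<Rightarrow> bool" where
  "environment \<mu> \<longleftrightarrow>
     prob_space \<mu> \<and> sets \<mu> = sets env_space \<and>
     stationary_under (distr \<mu> seq_space fst) (shift 1) \<and>
     stationary_under (distr \<mu> seq_space snd) (shift 1) \<and>
     (\<forall>k\<ge>1. \<forall>l\<ge>1. stationary_under \<mu> (map_prod (shift k) (shift l)) \<and>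
                    ergodic_under \<mu> (map_prod (shift k) (shift l)))"

definition law_a :: "((nat \<Rightarrow> real) \<times> (nat \<Rightarrow> real)) measure \<Rightarrow> real measure" where
  "law_a \<mu> = distr \<mu> borel (\<lambda>(a, b). a 0)"

definition law_b :: "((nat \<Rightarrow> real) \<times> (nat \<Rightarrow> real)) measure \<Rightarrow> real measure" where
  "law_b \<mu> = distr \<mu> borel (\<lambda>(a, b). b 0)"

definition measure_support :: "'a::topological_space measure \<Rightarrow> 'a set" where
  "measure_support \<eta> = {x. \<forall>U. open U \<and> x \<in> U \<longrightarrow> emeasure \<eta> U > 0}"

definition left_endpoint :: "real measure \<Rightarrow> ereal" where
  "left_endpoint \<eta> = Inf (ereal ` measure_support \<eta>)"

(* Weights take values in all of real here; the exponential laws put no mass on the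
   negative half-line. *)
definition weight_space :: "(nat \<times> nat \<Rightarrow> real) measure" where
  "weight_space = (\<Pi>\<^sub>M p\<in>UNIV. borel)"

definition quenched_law ::
  "(nat \<Rightarrow> real) \<times> (nat \<Rightarrow> real) \<Rightarrow> (nat \<times> nat \<Rightarrow> real) measure" where
  "quenched_law = (\<lambda>(a, b). \<Pi>\<^sub>M (i, j)\<in>UNIV. density lborel (exponential_density (a i + b j)))"

definition annealed_law ::
  "((nat \<Rightarrow> real) \<times> (nat \<Rightarrow> real)) measure \<Rightarrow> (nat \<times> nat \<Rightarrow> real) measure" where
  "annealed_law \<mu> = \<mu> \<bind> quenched_law"

fun G :: "(nat \<times> nat \<Rightarrow> real) \<Rightarrow> nat \<Rightarrow> nat \<Rightarrow> real" where
  "G w 0 j = 0"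
| "G w (Suc i) 0 = 0"
| "G w (Suc i) (Suc j) = max (G w i (Suc j)) (G w (Suc i) j) + w (i, j)"

(* The values of g outside s, t > 0 are irrelevant. *)
definition is_shape_function ::
  "((nat \<Rightarrow> real) \<times> (nat \<Rightarrow> real)) measure \<Rightarrow> (real \<Rightarrow> real \<Rightarrow> ennreal) \<Rightarrow> bool" where
  "is_shape_function \<mu> g \<longleftrightarrow>
     (AE w in annealed_law \<mu>. \<forall>s>0. \<forall>t>0.
        (\<lambda>n. ereal (G w (nat \<lfloor>real n * s\<rfloor>) (nat \<lfloor>real n * t\<rfloor>) / real n))
          \<longlonglongrightarrow> enn2ereal (g s t))"

(* Monadic bind returns junk for non-measurable kernels. The following facts show that
   quenched_law is a probability kernel, so that annealed_law is the intended mixture. *)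

lemma space_seq_space: "space seq_space = {c. \<forall>n. 0 < c n}"
  by (auto simp: seq_space_def space_PiM space_restrict_space PiE_UNIV_domain)

lemma space_env_space: "space env_space = {c. \<forall>n. 0 < c n} \<times> {c. \<forall>n. 0 < c n}"
  by (simp add: env_space_def space_pair_measure space_seq_space)

lemma measurable_seq_space_component: "(\<lambda>c. c n) \<in> borel_measurable seq_space"
proof -
  have "(\<lambda>c. c n) \<in> seq_space \<rightarrow>\<^sub>M restrict_space borel {0<..}"
    unfolding seq_space_def by (rule measurable_component_singleton) simp
  then show ?thesis
    by (simp add: measurable_restrict_space2_iff)
qed

lemma measurable_quenched_law: "quenched_law \<in> env_space \<rightarrow>\<^sub>M prob_algebra weight_space"
proof (rule measurable_prob_algebra_generated)
  let ?P = "prod_algebra UNIV (\<lambda>_::nat \<times> nat. borel :: real measure)"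
  show "sets weight_space = sigma_sets (\<Pi>\<^sub>E p\<in>UNIV. space borel) ?P"
    unfolding weight_space_def by (rule sets_PiM)
  show "Int_stable ?P" by (rule Int_stable_prod_algebra)
  show "?P \<subseteq> Pow (\<Pi>\<^sub>E p\<in>UNIV. space borel)" by (rule prod_algebra_sets_into_space)
next
  fix \<omega> assume "\<omega> \<in> space env_space"
  then have "0 < fst \<omega> i + snd \<omega> j" for i j
    by (auto simp: space_env_space add_pos_pos)
  then show "prob_space (quenched_law \<omega>)"
    by (auto simp: quenched_law_def split_beta intro!: prob_space_PiM prob_space_exponential_density)
  show "sets (quenched_law \<omega>) = sets weight_space"
    unfolding quenched_law_def weight_space_def by (auto simp: split_beta intro!: sets_PiM_cong)
next
  fix A assume "A \<in> prod_algebra UNIV (\<lambda>_::nat \<times> nat. borel :: real measure)"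
  then obtain J E where J: "A = prod_emb UNIV (\<lambda>_. borel :: real measure) J (Pi\<^sub>E J E)"
    "finite J" "\<And>p. p \<in> J \<Longrightarrow> E p \<in> sets borel"
    by (rule prod_algebraE) auto
  have comp [measurable]:
    "(\<lambda>\<omega>. fst \<omega> i) \<in> borel_measurable env_space" "(\<lambda>\<omega>. snd \<omega> i) \<in> borel_measurable env_space" for i
    unfolding env_space_def
    by (rule measurable_compose[OF measurable_fst measurable_seq_space_component],
        rule measurable_compose[OF measurable_snd measurable_seq_space_component])
  have "emeasure (quenched_law \<omega>) A =
      (\<Prod>(i, j)\<in>J. \<integral>\<^sup>+x. ennreal (exponential_density (fst \<omega> i + snd \<omega> j) x) * indicator (E (i, j)) x \<partial>lborel)"
    if "\<omega> \<in> space env_space" for \<omega>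
  proof -
    let ?D = "\<lambda>(i, j). density lborel (exponential_density (fst \<omega> i + snd \<omega> j))"
    have pos: "0 < fst \<omega> i + snd \<omega> j" for i j
      using that by (auto simp: space_env_space add_pos_pos)
    have "A = prod_emb UNIV ?D J (Pi\<^sub>E J E)"
      unfolding J(1) prod_emb_def by (simp add: split_beta)
    moreover have "quenched_law \<omega> = Pi\<^sub>M UNIV ?D"
      by (simp add: quenched_law_def split_beta)
    moreover have "emeasure (Pi\<^sub>M UNIV ?D) (prod_emb UNIV ?D J (Pi\<^sub>E J E)) = (\<Prod>p\<in>J. emeasure (?D p) (E p))"
      using J(2,3) pos
      by (intro emeasure_PiM_emb) (auto intro!: prob_space_exponential_density)
    ultimately have "emeasure (quenched_law \<omega>) A = (\<Prod>p\<in>J. emeasure (?D p) (E p))"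
      by (simp only:)
    also have "\<dots> = (\<Prod>(i, j)\<in>J. \<integral>\<^sup>+x. ennreal (exponential_density (fst \<omega> i + snd \<omega> j) x) * indicator (E (i, j)) x \<partial>lborel)"
      using J(3) by (intro prod.cong) (auto simp: emeasure_density split_beta)
    finally show ?thesis .
  qed
  moreover have "(\<lambda>\<omega>. \<Prod>(i, j)\<in>J. \<integral>\<^sup>+x. ennreal (exponential_density (fst \<omega> i + snd \<omega> j) x) * indicator (E (i, j)) x \<partial>lborel)
      \<in> borel_measurable env_space"
    unfolding split_beta
  proof (rule borel_measurable_prod_ennreal)
    fix p assume "p \<in> J"
    then have [measurable]: "E p \<in> sets borel" by (rule J(3))
    show "(\<lambda>\<omega>. \<integral>\<^sup>+x. ennreal (exponential_density (fst \<omega> (fst p) + snd \<omega> (snd p)) x) * indicator (E (fst p, snd p)) x \<partial>lborel)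
      \<in> borel_measurable env_space"
      unfolding exponential_density_def prod.collapse by measurable
  qed
  ultimately show "(\<lambda>\<omega>. emeasure (quenched_law \<omega>) A) \<in> borel_measurable env_space"
    by (simp cong: measurable_cong)
qed

lemma emeasure_annealed_law:
  assumes "environment \<mu>" "X \<in> sets weight_space"
  shows "emeasure (annealed_law \<mu>) X = (\<integral>\<^sup>+\<omega>. emeasure (quenched_law \<omega>) X \<partial>\<mu>)"
proof -
  have p: "prob_space \<mu>" and s: "sets \<mu> = sets env_space"
    using assms(1) by (auto simp: environment_def)
  have "quenched_law \<in> \<mu> \<rightarrow>\<^sub>M prob_algebra weight_space"
    using measurable_quenched_law by (simp add: measurable_cong_sets[OF s refl])
  then have "quenched_law \<in> \<mu> \<rightarrow>\<^sub>M subprob_algebra weight_space"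
    by (rule measurable_prob_algebraD)
  then show ?thesis
    unfolding annealed_law_def
    using emeasure_bind[OF prob_space.not_empty[OF p] _ assms(2)] by blast
qed

end

theory Submission
  imports Defs
begin

text \<open>
  The value \<open>s E[1/a] + t E[1/b]\<close> bounds \<open>g s t\<close> from both sides. Since \<open>g s t\<close> is a constant and
  the almost sure convergence of \<open>G/n\<close> to it is given, it suffices to estimate
  expectations of \<open>G\<close>; stationarity of the environment then evaluates the averages, and no ergodic
  theorem enters.

  Upper bound. Put independent boundary weights on the two axes, exponential with rate \<open>a i\<close> on the
  horizontal one and \<open>b j\<close> on the vertical one. By the Burke property of exponential weights
  (\<open>burke_integral\<close>) a corner with independent increments of rates \<open>a\<close>, \<open>b\<close> and a
  weight of rate \<open>a + b\<close> turns into a corner with independent increments of the same rates. Flipping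
  corners one at a time shows that every horizontal increment of the passage times with boundary has
  rate \<open>a i\<close> (\<open>burke_front\<close>). These passage times dominate \<open>G\<close>, so given the environment the
  expectation of \<open>G m n\<close> is at most the sum of the first \<open>m\<close> values \<open>1 / a i\<close> and the first \<open>n\<close>
  values \<open>1 / b j\<close> (\<open>quenched_upper_bound\<close>). Fatou's lemma transfers this to \<open>g\<close>
  (\<open>shape_upper_bound\<close>).

  Lower bound. Fix \<open>d > 0\<close>. The left endpoints being 0, ergodicity makes a row \<open>J\<close> with \<open>b J < d\<close>
  appear among the first \<open>N\<close> rows, and a column \<open>I\<close> with \<open>a I < d\<close> among the last \<open>N\<close> of the \<open>m\<close>
  columns, with probability close to 1 for large \<open>N\<close> (\<open>avoid_window_tendsto_0\<close>). The path that follows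
  row \<open>J\<close> and then column \<open>I\<close> collects weights of mean at least \<open>1 / (a i + d)\<close> and
  \<open>1 / (b j + d)\<close>. Truncating the weights makes the resulting lower bound for \<open>G/n\<close> uniformly bounded,
  so that dominated convergence applies (\<open>shape_lower_bound_regularized\<close>). Monotone convergence as
  \<open>d\<close> tends to 0 concludes.
\<close>

section \<open>The Burke property of exponential weights\<close>

abbreviation exp_law :: "real \<Rightarrow> real measure" where
  "exp_law l \<equiv> density lborel (exponential_density l)"

lemma nn_integral_exp_law:
  assumes "f \<in> borel_measurable borel"
  shows "(\<integral>\<^sup>+x. f x \<partial>exp_law l) = (\<integral>\<^sup>+x. ennreal (exponential_density l x) * f x \<partial>lborel)"
  using assms by (subst nn_integral_density) auto

lemma sigma_finite_exp_law: "0 < l \<Longrightarrow> sigma_finite_measure (exp_law l)"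
  using prob_space_exponential_density by (simp add: prob_space_imp_sigma_finite)

lemma exponential_density_exchange:
  assumes "0 < a" "0 < b" "0 \<le> d"
  shows "ennreal (exponential_density (a + b) w) * (ennreal (exponential_density b j) * ennreal (exponential_density a (j + d))) =
         ennreal (exponential_density (a + b) j) * (ennreal (exponential_density b w) * ennreal (exponential_density a (w + d)))"
proof (cases "0 \<le> j \<and> 0 \<le> w")
  case True
  have "exponential_density (a + b) w * (exponential_density b j * exponential_density a (j + d)) =
        exponential_density (a + b) j * (exponential_density b w * exponential_density a (w + d))"
    using True assms by (simp add: exponential_density_def exp_add[symmetric] algebra_simps)
  then show ?thesis
    using assms by (simp add: ennreal_mult[symmetric] exponential_density_nonneg)
next
  case False
  then show ?thesis by (auto simp: exponential_density_def)
qed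

text \<open>
  On \<open>j \<le> i\<close>, write \<open>i = j + d\<close>. The joint density at \<open>(w, j, d)\<close> does not change when \<open>w\<close> and
  \<open>j = min i j\<close> are exchanged, so the minimum can be integrated out with total mass 1 while \<open>w\<close> takes
  over its role.
\<close>

lemma burke_half:
  assumes a: "0 < a" and b: "0 < b" and F [measurable]: "F \<in> borel_measurable (borel \<Otimes>\<^sub>M borel)"
  shows "(\<integral>\<^sup>+w. \<integral>\<^sup>+j. \<integral>\<^sup>+i. (if j \<le> i then F (w + (i - j), w) else 0) \<partial>exp_law a \<partial>exp_law b \<partial>exp_law (a + b)) =
         (\<integral>\<^sup>+j. \<integral>\<^sup>+i. (if j \<le> i then F (i, j) else 0) \<partial>exp_law a \<partial>exp_law b)" (is "?L = ?R")
proof -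
  let ?r = "\<lambda>l x. ennreal (exponential_density l x)"
  interpret A: sigma_finite_measure "exp_law a" by (rule sigma_finite_exp_law[OF a])
  interpret B: sigma_finite_measure "exp_law b" by (rule sigma_finite_exp_law[OF b])
  have shift: "(\<integral>\<^sup>+i. (if j \<le> i then h i else 0) \<partial>exp_law a) =
      (\<integral>\<^sup>+d. ?r a (j + d) * (if 0 \<le> d then h (j + d) else 0) \<partial>lborel)"
    if [measurable]: "h \<in> borel_measurable borel" for h :: "real \<Rightarrow> ennreal" and j
    by (subst nn_integral_exp_law, measurable, subst nn_integral_real_affine[where c=1 and t=j])
       (auto intro!: nn_integral_cong)
  define K where "K w d = ?r b w * ?r a (w + d) * (if 0 \<le> d then F (w + d, w) else 0)" for w d
  have [measurable]: "case_prod K \<in> borel_measurable (borel \<Otimes>\<^sub>M borel)"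
    unfolding K_def by measurable
  have "?L = (\<integral>\<^sup>+w. ?r (a+b) w * (\<integral>\<^sup>+j. \<integral>\<^sup>+i. (if j \<le> i then F (w + (i - j), w) else 0) \<partial>exp_law a \<partial>exp_law b) \<partial>lborel)"
    by (rule nn_integral_exp_law) measurable
  also have "\<dots> = (\<integral>\<^sup>+w. ?r (a+b) w * (\<integral>\<^sup>+j. ?r b j * (\<integral>\<^sup>+i. (if j \<le> i then F (w + (i - j), w) else 0) \<partial>exp_law a) \<partial>lborel) \<partial>lborel)"
    by (intro nn_integral_cong arg_cong2[where f="(*)"] refl nn_integral_exp_law) measurable
  also have "\<dots> = (\<integral>\<^sup>+w. ?r (a+b) w * (\<integral>\<^sup>+j. ?r b j * (\<integral>\<^sup>+d. ?r a (j + d) * (if 0 \<le> d then F (w + d, w) else 0) \<partial>lborel) \<partial>lborel) \<partial>lborel)"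
    by (subst shift) (simp_all cong: if_cong)
  also have "\<dots> = (\<integral>\<^sup>+w. \<integral>\<^sup>+j. \<integral>\<^sup>+d. ?r (a+b) w * (?r b j * ?r a (j + d)) * (if 0 \<le> d then F (w + d, w) else 0) \<partial>lborel \<partial>lborel \<partial>lborel)"
    by (simp add: nn_integral_cmult[symmetric] mult.assoc)
  also have "\<dots> = (\<integral>\<^sup>+w. \<integral>\<^sup>+j. \<integral>\<^sup>+d. ?r (a+b) j * K w d \<partial>lborel \<partial>lborel \<partial>lborel)"
  proof (intro nn_integral_cong)
    fix w j d :: real
    show "?r (a+b) w * (?r b j * ?r a (j + d)) * (if 0 \<le> d then F (w + d, w) else 0) = ?r (a+b) j * K w d"
    proof (cases "0 \<le> d")
      case True
      show ?thesis
        unfolding exponential_density_exchange[OF a b True] K_def by (simp add: mult.assoc)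
    qed (simp add: K_def)
  qed
  also have "\<dots> = (\<integral>\<^sup>+w. \<integral>\<^sup>+j. ?r (a+b) j * (\<integral>\<^sup>+d. K w d \<partial>lborel) \<partial>lborel \<partial>lborel)"
    by (simp add: nn_integral_cmult)
  also have "\<dots> = (\<integral>\<^sup>+w. (\<integral>\<^sup>+j. ?r (a+b) j \<partial>lborel) * (\<integral>\<^sup>+d. K w d \<partial>lborel) \<partial>lborel)"
    by (simp add: nn_integral_multc)
  also have "(\<integral>\<^sup>+j. ?r (a+b) j \<partial>lborel) = 1"
    using nn_integral_erlang_ith_moment[of "a+b" 0 0] a b by simp
  also have "(\<integral>\<^sup>+w. 1 * (\<integral>\<^sup>+d. K w d \<partial>lborel) \<partial>lborel) = (\<integral>\<^sup>+w. ?r b w * (\<integral>\<^sup>+d. ?r a (w + d) * (if 0 \<le> d then F (w + d, w) else 0) \<partial>lborel) \<partial>lborel)"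
    by (simp add: K_def nn_integral_cmult[symmetric] mult.assoc)
  also have "\<dots> = (\<integral>\<^sup>+j. ?r b j * (\<integral>\<^sup>+i. (if j \<le> i then F (i, j) else 0) \<partial>exp_law a) \<partial>lborel)"
    by (subst shift) auto
  also have "\<dots> = ?R"
    by (rule nn_integral_exp_law[symmetric]) measurable
  finally show ?thesis .
qed

text \<open>
  Here \<open>i\<close> and \<open>j\<close> are the horizontal and vertical increments entering a corner and \<open>w\<close> is the weight
  in it; the arguments of \<open>F\<close> are the increments leaving it. The case \<open>i < j\<close> is the mirror image of
  the case \<open>j \<le> i\<close>.
\<close>

lemma burke_integral:
  assumes a: "0 < a" and b: "0 < b" and F [measurable]: "F \<in> borel_measurable (borel \<Otimes>\<^sub>M borel)"
  shows "(\<integral>\<^sup>+w. \<integral>\<^sup>+j. \<integral>\<^sup>+i. F (w + max (i - j) 0, w + max (j - i) 0) \<partial>exp_law a \<partial>exp_law b \<partial>exp_law (a + b)) =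
         (\<integral>\<^sup>+j. \<integral>\<^sup>+i. F (i, j) \<partial>exp_law a \<partial>exp_law b)" (is "?L = ?R")
proof -
  interpret A: sigma_finite_measure "exp_law a" by (rule sigma_finite_exp_law[OF a])
  interpret B: sigma_finite_measure "exp_law b" by (rule sigma_finite_exp_law[OF b])
  interpret P: pair_sigma_finite "exp_law a" "exp_law b" ..
  \<comment> \<open>The diagonal already belongs to the case \<open>j \<le> i\<close>, hence the value 0 there.\<close>
  define F' where "F' = (\<lambda>(y, x). if x = y then 0 else F (x, y))"
  have [measurable]: "F' \<in> borel_measurable (borel \<Otimes>\<^sub>M borel)"
    unfolding F'_def by measurable
  have split: "F (w + max (i - j) 0, w + max (j - i) 0) =
      (if j \<le> i then F (w + (i - j), w) else 0) + (if i \<le> j then F' (w + (j - i), w) else 0)" for w i j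
    by (auto simp: F'_def)
  have "?L = (\<integral>\<^sup>+w. (\<integral>\<^sup>+j. \<integral>\<^sup>+i. (if j \<le> i then F (w + (i - j), w) else 0) \<partial>exp_law a \<partial>exp_law b)
     + (\<integral>\<^sup>+j. \<integral>\<^sup>+i. (if i \<le> j then F' (w + (j - i), w) else 0) \<partial>exp_law a \<partial>exp_law b) \<partial>exp_law (a + b))"
    by (simp add: split nn_integral_add)
  also have "\<dots> = (\<integral>\<^sup>+w. (\<integral>\<^sup>+j. \<integral>\<^sup>+i. (if j \<le> i then F (w + (i - j), w) else 0) \<partial>exp_law a \<partial>exp_law b) \<partial>exp_law (a + b))
     + (\<integral>\<^sup>+w. (\<integral>\<^sup>+j. \<integral>\<^sup>+i. (if i \<le> j then F' (w + (j - i), w) else 0) \<partial>exp_law a \<partial>exp_law b) \<partial>exp_law (b + a))"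
    by (simp add: nn_integral_add add.commute)
  also have "(\<integral>\<^sup>+w. (\<integral>\<^sup>+j. \<integral>\<^sup>+i. (if i \<le> j then F' (w + (j - i), w) else 0) \<partial>exp_law a \<partial>exp_law b) \<partial>exp_law (b + a)) =
    (\<integral>\<^sup>+w. (\<integral>\<^sup>+i. \<integral>\<^sup>+j. (if i \<le> j then F' (w + (j - i), w) else 0) \<partial>exp_law b \<partial>exp_law a) \<partial>exp_law (b + a))"
    by (intro nn_integral_cong P.Fubini') measurable
  also have "\<dots> = (\<integral>\<^sup>+i. \<integral>\<^sup>+j. (if i \<le> j then F' (j, i) else 0) \<partial>exp_law b \<partial>exp_law a)"
    by (rule burke_half[OF b a]) measurable
  also have "\<dots> = (\<integral>\<^sup>+j. \<integral>\<^sup>+i. (if i \<le> j then F' (j, i) else 0) \<partial>exp_law a \<partial>exp_law b)"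
    by (rule P.Fubini'[symmetric]) measurable
  also have "(\<integral>\<^sup>+w. \<integral>\<^sup>+j. \<integral>\<^sup>+i. (if j \<le> i then F (w + (i - j), w) else 0) \<partial>exp_law a \<partial>exp_law b \<partial>exp_law (a + b)) =
         (\<integral>\<^sup>+j. \<integral>\<^sup>+i. (if j \<le> i then F (i, j) else 0) \<partial>exp_law a \<partial>exp_law b)"
    by (rule burke_half[OF a b F])
  also have "\<dots> + (\<integral>\<^sup>+j. \<integral>\<^sup>+i. (if i \<le> j then F' (j, i) else 0) \<partial>exp_law a \<partial>exp_law b) =
    (\<integral>\<^sup>+j. \<integral>\<^sup>+i. (if j \<le> i then F (i, j) else 0) + (if i \<le> j then F' (j, i) else 0) \<partial>exp_law a \<partial>exp_law b)"
    by (simp add: nn_integral_add)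
  also have "\<dots> = ?R"
    by (intro nn_integral_cong) (auto simp: F'_def)
  finally show ?thesis .
qed

text \<open>
  This extracts from the block \<open>{p, q, r}\<close>, which is independent of all other indices, two functions
  that are independent of each other. They take the places of \<open>p\<close> and \<open>q\<close>, and \<open>r\<close> is used up.
\<close>

lemma (in prob_space) indep_vars_replace_pair:
  fixes X :: "'i \<Rightarrow> 'a \<Rightarrow> real" and u v :: "real \<times> real \<times> real \<Rightarrow> real"
  assumes ind: "indep_vars (\<lambda>_. borel) X K"
    and pqr: "p \<in> K" "q \<in> K" "r \<in> K" "p \<noteq> q" "p \<noteq> r" "q \<noteq> r"
    and u [measurable]: "u \<in> borel_measurable (borel \<Otimes>\<^sub>M borel \<Otimes>\<^sub>M borel)"
    and v [measurable]: "v \<in> borel_measurable (borel \<Otimes>\<^sub>M borel \<Otimes>\<^sub>M borel)"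
    and U: "U = (\<lambda>\<omega>. u (X p \<omega>, X q \<omega>, X r \<omega>))" and V: "V = (\<lambda>\<omega>. v (X p \<omega>, X q \<omega>, X r \<omega>))"
    and UV: "\<And>A B. A \<in> sets borel \<Longrightarrow> B \<in> sets borel \<Longrightarrow>
      prob {\<omega> \<in> space M. U \<omega> \<in> A \<and> V \<omega> \<in> B} = prob (U -` A \<inter> space M) * prob (V -` B \<inter> space M)"
  shows "indep_vars (\<lambda>_. borel) (X(p := U, q := V)) (K - {r})"
proof -
  have rv [measurable]: "random_variable borel (X i)" if "i \<in> K" for i
    using ind that by (auto simp: indep_vars_def2)
  have [measurable]: "random_variable borel U" "random_variable borel V"
    unfolding U V using pqr by measurable
  show ?thesis
    unfolding indep_vars_def2
  proof (intro conjI ballI indep_setsI)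
    fix i assume "i \<in> K - {r}"
    then show "random_variable borel ((X(p := U, q := V)) i)" by auto
    then show "{(X(p := U, q := V)) i -` A \<inter> space M |A. A \<in> sets borel} \<subseteq> events"
      by (auto intro: measurable_sets)
  next
    fix A J assume J: "J \<noteq> {}" "J \<subseteq> K - {r}" "finite J"
      and "\<forall>j\<in>J. A j \<in> {(X(p := U, q := V)) j -` A \<inter> space M |A. A \<in> sets borel}"
    then have "\<forall>j\<in>J. \<exists>B. B \<in> sets borel \<and> A j = (X(p := U, q := V)) j -` B \<inter> space M"
      by blast
    then obtain B where B [measurable]: "\<And>j. j \<in> J \<Longrightarrow> B j \<in> sets borel"
      and A: "\<And>j. j \<in> J \<Longrightarrow> A j = (X(p := U, q := V)) j -` B j \<inter> space M"
      by metis
    define J' where "J' = J - {p, q}"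
    define Bp where "Bp = (if p \<in> J then B p else UNIV)"
    define Bq where "Bq = (if q \<in> J then B q else UNIV)"
    have BpBq [measurable]: "Bp \<in> sets borel" "Bq \<in> sets borel"
      unfolding Bp_def Bq_def by (auto intro: B)
    define R where "R = {\<omega> \<in> space M. \<forall>j\<in>J'. X j \<omega> \<in> B j}"
    have J': "finite J'" "J' \<subseteq> K" "J' \<subseteq> J" "{p, q, r} \<inter> J' = {}"
      using J by (auto simp: J'_def)
    let ?Q = "\<Pi>\<^sub>M i\<in>{p, q, r}. borel :: real measure" and ?R = "\<Pi>\<^sub>M i\<in>J'. borel :: real measure"
    have iv: "indep_var ?Q (\<lambda>\<omega>. restrict (\<lambda>i. X i \<omega>) {p, q, r}) ?R (\<lambda>\<omega>. restrict (\<lambda>i. X i \<omega>) J')"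
      using J' pqr by (intro indep_var_restrict[OF ind]) auto
    let ?C = "{x \<in> space ?Q. u (x p, x q, x r) \<in> Bp \<and> v (x p, x q, x r) \<in> Bq}"
    let ?D = "{x \<in> space ?R. \<forall>j\<in>J'. x j \<in> B j}"
    have C: "?C \<in> sets ?Q" by measurable
    have D: "?D \<in> sets ?R"
    proof -
      have "?D = Pi\<^sub>E J' B" by (auto simp: space_PiM PiE_iff extensional_def)
      then show ?thesis using J' B by (auto intro!: sets_PiM_I_finite)
    qed
    \<comment> \<open>The event splits into one about the block \<open>{p, q, r}\<close> and one about \<open>J'\<close>.\<close>
    have "(\<Inter>j\<in>J. A j) = (\<lambda>\<omega>. (restrict (\<lambda>i. X i \<omega>) {p, q, r}, restrict (\<lambda>i. X i \<omega>) J')) -` (?C \<times> ?D) \<inter> space M"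
      (is "?lhs = ?rhs")
    proof -
      have "\<omega> \<in> ?lhs \<longleftrightarrow> \<omega> \<in> ?rhs" for \<omega>
      proof -
        have "\<omega> \<in> ?rhs \<longleftrightarrow> \<omega> \<in> space M \<and> U \<omega> \<in> Bp \<and> V \<omega> \<in> Bq \<and> (\<forall>j\<in>J'. X j \<omega> \<in> B j)"
          using pqr by (auto simp: space_PiM PiE_iff U V)
        moreover have "\<omega> \<in> ?lhs \<longleftrightarrow> \<omega> \<in> space M \<and> (\<forall>j\<in>J. (X(p := U, q := V)) j \<omega> \<in> B j)"
          using A J(1) by auto
        moreover have "(\<forall>j\<in>J. (X(p := U, q := V)) j \<omega> \<in> B j) \<longleftrightarrow> U \<omega> \<in> Bp \<and> V \<omega> \<in> Bq \<and> (\<forall>j\<in>J'. X j \<omega> \<in> B j)"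
          using pqr(4) by (auto simp: J'_def Bp_def Bq_def)
        ultimately show ?thesis by simp
      qed
      then show ?thesis by blast
    qed
    then have "prob (\<Inter>j\<in>J. A j) = prob ((\<lambda>\<omega>. restrict (\<lambda>i. X i \<omega>) {p, q, r}) -` ?C \<inter> space M) *
        prob ((\<lambda>\<omega>. restrict (\<lambda>i. X i \<omega>) J') -` ?D \<inter> space M)"
      using indep_varD[OF iv C D] by simp
    also have "(\<lambda>\<omega>. restrict (\<lambda>i. X i \<omega>) {p, q, r}) -` ?C \<inter> space M = {\<omega> \<in> space M. U \<omega> \<in> Bp \<and> V \<omega> \<in> Bq}"
      by (auto simp: space_PiM PiE_iff U V)
    also have "prob \<dots> = prob (U -` Bp \<inter> space M) * prob (V -` Bq \<inter> space M)"
      by (rule UV) measurable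
    also have "prob (U -` Bp \<inter> space M) = (if p \<in> J then prob (A p) else 1)"
      using pqr(4) A by (auto simp: Bp_def prob_space)
    also have "prob (V -` Bq \<inter> space M) = (if q \<in> J then prob (A q) else 1)"
      using A by (auto simp: Bq_def prob_space)
    also have "prob ((\<lambda>\<omega>. restrict (\<lambda>i. X i \<omega>) J') -` ?D \<inter> space M) = (\<Prod>j\<in>J'. prob (A j))"
    proof (cases "J' = {}")
      case True
      then show ?thesis by (auto simp: space_PiM prob_space intro!: arg_cong[where f=prob] trans[OF _ prob_space])
    next
      case False
      then have "(\<lambda>\<omega>. restrict (\<lambda>i. X i \<omega>) J') -` ?D \<inter> space M = (\<Inter>j\<in>J'. X j -` B j \<inter> space M)"
        by (auto simp: space_PiM PiE_iff)
      also have "prob \<dots> = (\<Prod>j\<in>J'. prob (X j -` B j \<inter> space M))"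
        using J' B False by (intro indep_varsD[OF ind]) auto
      also have "\<dots> = (\<Prod>j\<in>J'. prob (A j))"
        using J' A by (intro prod.cong refl) (auto simp: J'_def)
      finally show ?thesis .
    qed
    also have "(if p \<in> J then prob (A p) else 1) * (if q \<in> J then prob (A q) else 1) * (\<Prod>j\<in>J'. prob (A j)) = (\<Prod>j\<in>J. prob (A j))"
    proof -
      have "(\<Prod>j\<in>J. prob (A j)) = (\<Prod>j\<in>J \<inter> {p, q}. prob (A j)) * (\<Prod>j\<in>J'. prob (A j))"
        unfolding J'_def using J(3) by (subst prod.Int_Diff[where B="{p, q}"]) auto
      also have "(\<Prod>j\<in>J \<inter> {p, q}. prob (A j)) = (if p \<in> J then prob (A p) else 1) * (if q \<in> J then prob (A q) else 1)"
        using pqr(4) by (auto simp: Int_insert_right)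
      finally show ?thesis by simp
    qed
    finally show "prob (\<Inter>j\<in>J. A j) = (\<Prod>j\<in>J. prob (A j))" .
  qed
qed

lemma (in prob_space) burke_joint_law:
  fixes X :: "'i \<Rightarrow> 'a \<Rightarrow> real"
  assumes a: "0 < a" and b: "0 < b"
    and ind: "indep_vars (\<lambda>_. borel) X {p, q, r}" and ne: "p \<noteq> q" "p \<noteq> r" "q \<noteq> r"
    and law: "distr M borel (X p) = exp_law a" "distr M borel (X q) = exp_law b"
      "distr M borel (X r) = exp_law (a + b)"
    and A [measurable]: "A \<in> sets borel" and B [measurable]: "B \<in> sets borel"
  shows "emeasure M {\<omega> \<in> space M. X r \<omega> + max (X p \<omega> - X q \<omega>) 0 \<in> A \<and> X r \<omega> + max (X q \<omega> - X p \<omega>) 0 \<in> B} =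
    emeasure (exp_law a) A * emeasure (exp_law b) B"
proof -
  define E where "E = (\<lambda>i. if i = p then exp_law a else if i = q then exp_law b else exp_law (a + b))"
  have E [simp]: "E p = exp_law a" "E q = exp_law b" "E r = exp_law (a + b)"
    using ne by (auto simp: E_def)
  have setsE [measurable_cong]: "sets (E i) = sets borel" for i by (simp add: E_def)
  have pE: "prob_space (E i)" for i
    using a b by (auto simp: E_def intro!: prob_space_exponential_density)
  interpret E: product_prob_space E "{p, q, r}"
    using pE by (simp add: product_prob_spaceI)
  have rv [measurable]: "random_variable borel (X p)" "random_variable borel (X q)" "random_variable borel (X r)"
    using ind by (auto simp: indep_vars_def2)
  define F :: "real \<times> real \<Rightarrow> ennreal" where "F = (\<lambda>(x, y). indicator A x * indicator B y)"
  have [measurable]: "F \<in> borel_measurable (borel \<Otimes>\<^sub>M borel)" unfolding F_def by measurable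
  define H where "H = (\<lambda>x :: 'i \<Rightarrow> real. F (x r + max (x p - x q) 0, x r + max (x q - x p) 0))"
  have H [measurable]: "H \<in> borel_measurable (Pi\<^sub>M {p, q, r} (\<lambda>_. borel))"
    unfolding H_def by measurable
  have "distr M (Pi\<^sub>M {p, q, r} (\<lambda>_. borel)) (\<lambda>x. \<lambda>i\<in>{p, q, r}. X i x) = Pi\<^sub>M {p, q, r} (\<lambda>i. distr M borel (X i))"
    using ind rv by (subst (asm) indep_vars_iff_distr_eq_PiM') auto
  also have "\<dots> = Pi\<^sub>M {p, q, r} E"
    using law ne by (intro PiM_cong refl) auto
  finally have joint: "distr M (Pi\<^sub>M {p, q, r} (\<lambda>_. borel)) (\<lambda>x. \<lambda>i\<in>{p, q, r}. X i x) = Pi\<^sub>M {p, q, r} E" .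
  have "emeasure M {\<omega> \<in> space M. X r \<omega> + max (X p \<omega> - X q \<omega>) 0 \<in> A \<and> X r \<omega> + max (X q \<omega> - X p \<omega>) 0 \<in> B}
    = (\<integral>\<^sup>+\<omega>. indicator {\<omega> \<in> space M. X r \<omega> + max (X p \<omega> - X q \<omega>) 0 \<in> A \<and> X r \<omega> + max (X q \<omega> - X p \<omega>) 0 \<in> B} \<omega> \<partial>M)"
    by (subst nn_integral_indicator) auto
  also have "\<dots> = (\<integral>\<^sup>+\<omega>. H (\<lambda>i\<in>{p, q, r}. X i \<omega>) \<partial>M)"
    by (intro nn_integral_cong) (auto simp: H_def F_def indicator_def)
  also have "\<dots> = (\<integral>\<^sup>+x. H x \<partial>distr M (Pi\<^sub>M {p, q, r} (\<lambda>_. borel)) (\<lambda>x. \<lambda>i\<in>{p, q, r}. X i x))"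
  proof (rule nn_integral_distr[symmetric])
    show "(\<lambda>x. \<lambda>i\<in>{p, q, r}. X i x) \<in> M \<rightarrow>\<^sub>M Pi\<^sub>M {p, q, r} (\<lambda>_. borel)"
      by (rule measurable_restrict) auto
  qed (use H in simp)
  also have "\<dots> = (\<integral>\<^sup>+x. H x \<partial>Pi\<^sub>M {p, q, r} E)" unfolding joint ..
  also have "{p, q, r} = insert r (insert q {p})" by auto
  also have "(\<integral>\<^sup>+x. H x \<partial>Pi\<^sub>M (insert r (insert q {p})) E) =
     (\<integral>\<^sup>+w. \<integral>\<^sup>+x. H (x(r := w)) \<partial>Pi\<^sub>M (insert q {p}) E \<partial>E r)"
    unfolding H_def using ne by (subst E.product_nn_integral_insert_rev) auto
  also have "\<dots> = (\<integral>\<^sup>+w. \<integral>\<^sup>+j. \<integral>\<^sup>+x. H (x(q := j, r := w)) \<partial>Pi\<^sub>M {p} E \<partial>E q \<partial>E r)"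
    unfolding H_def using ne by (subst E.product_nn_integral_insert_rev) auto
  also have "\<dots> = (\<integral>\<^sup>+w. \<integral>\<^sup>+j. \<integral>\<^sup>+i. F (w + max (i - j) 0, w + max (j - i) 0) \<partial>E p \<partial>E q \<partial>E r)"
    unfolding H_def using ne
    by (subst E.product_nn_integral_singleton[symmetric, where i=p]) (auto)
  also have "\<dots> = (\<integral>\<^sup>+j. \<integral>\<^sup>+i. F (i, j) \<partial>exp_law a \<partial>exp_law b)"
    unfolding E by (rule burke_integral[OF a b]) measurable
  also have "\<dots> = emeasure (exp_law a) A * emeasure (exp_law b) B"
    by (simp add: F_def nn_integral_multc nn_integral_cmult)
  finally show ?thesis .
qed

text \<open>
  One corner flip inside a family of independent variables: \<open>p\<close> and \<open>q\<close> hold the increments at a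
  corner, \<open>r\<close> its weight, and the outgoing increments are stored again at \<open>p\<close> and \<open>q\<close>.
\<close>

lemma (in prob_space) burke_step:
  fixes X :: "'i \<Rightarrow> 'a \<Rightarrow> real"
  assumes a: "0 < a" and b: "0 < b"
    and ind: "indep_vars (\<lambda>_. borel) X K"
    and pqr: "p \<in> K" "q \<in> K" "r \<in> K" "p \<noteq> q" "p \<noteq> r" "q \<noteq> r"
    and law: "distr M borel (X p) = exp_law a" "distr M borel (X q) = exp_law b"
      "distr M borel (X r) = exp_law (a + b)"
  defines "U \<equiv> \<lambda>\<omega>. X r \<omega> + max (X p \<omega> - X q \<omega>) 0"
    and "V \<equiv> \<lambda>\<omega>. X r \<omega> + max (X q \<omega> - X p \<omega>) 0"
  shows "indep_vars (\<lambda>_. borel) (X(p := U, q := V)) (K - {r})"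
    and "distr M borel U = exp_law a" and "distr M borel V = exp_law b"
proof -
  have rv [measurable]: "random_variable borel (X p)" "random_variable borel (X q)" "random_variable borel (X r)"
    using ind pqr by (auto simp: indep_vars_def2)
  have [measurable]: "random_variable borel U" "random_variable borel V"
    unfolding U_def V_def by measurable
  have ind3: "indep_vars (\<lambda>_. borel) X {p, q, r}"
    using pqr by (intro indep_vars_subset[OF ind]) auto
  have J: "emeasure M {\<omega> \<in> space M. U \<omega> \<in> A \<and> V \<omega> \<in> B} = emeasure (exp_law a) A * emeasure (exp_law b) B"
    if "A \<in> sets borel" "B \<in> sets borel" for A B
    unfolding U_def V_def by (rule burke_joint_law[OF a b ind3 pqr(4-6) law that])
  interpret A: prob_space "exp_law a" by (rule prob_space_exponential_density[OF a])
  interpret B: prob_space "exp_law b" by (rule prob_space_exponential_density[OF b])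
  have one: "emeasure (exp_law a) UNIV = 1" "emeasure (exp_law b) UNIV = 1"
    using A.emeasure_space_1 B.emeasure_space_1 by simp_all
  show U: "distr M borel U = exp_law a"
  proof (rule measure_eqI)
    fix C assume "C \<in> sets (distr M borel U)"
    then have C: "C \<in> sets borel" by simp
    then have "emeasure (distr M borel U) C = emeasure M {\<omega> \<in> space M. U \<omega> \<in> C \<and> V \<omega> \<in> UNIV}"
      by (subst emeasure_distr) (auto intro!: arg_cong[where f="emeasure M"])
    then show "emeasure (distr M borel U) C = emeasure (exp_law a) C"
      using J[OF C, of UNIV] one by simp
  qed simp
  show V: "distr M borel V = exp_law b"
  proof (rule measure_eqI)
    fix C assume "C \<in> sets (distr M borel V)"
    then have C: "C \<in> sets borel" by simp
    then have "emeasure (distr M borel V) C = emeasure M {\<omega> \<in> space M. U \<omega> \<in> UNIV \<and> V \<omega> \<in> C}"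
      by (subst emeasure_distr) (auto intro!: arg_cong[where f="emeasure M"])
    then show "emeasure (distr M borel V) C = emeasure (exp_law b) C"
      using J[OF _ C, of UNIV] one by simp
  qed simp
  show "indep_vars (\<lambda>_. borel) (X(p := U, q := V)) (K - {r})"
  proof (rule indep_vars_replace_pair[OF ind pqr, of "\<lambda>(x, y, z). z + max (x - y) 0" "\<lambda>(x, y, z). z + max (y - x) 0"])
    fix C D :: "real set" assume CD: "C \<in> sets borel" "D \<in> sets borel"
    have "emeasure M (U -` C \<inter> space M) = emeasure (exp_law a) C"
      using CD by (simp add: emeasure_distr U[symmetric])
    moreover have "emeasure M (V -` D \<inter> space M) = emeasure (exp_law b) D"
      using CD by (simp add: emeasure_distr V[symmetric])
    ultimately show "prob {\<omega> \<in> space M. U \<omega> \<in> C \<and> V \<omega> \<in> D} = prob (U -` C \<inter> space M) * prob (V -` D \<inter> space M)"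
      using J[OF CD] by (simp add: measure_def enn2real_mult)
  qed (auto simp: U_def V_def)
qed

section \<open>Last-passage times with stationary boundary\<close>

text \<open>
  The index \<open>(Suc i, Suc j)\<close> carries the weight \<open>w (i, j)\<close> of the quadrant; the two axes carry the
  boundary weights.
\<close>

fun boundary_G :: "(nat \<times> nat \<Rightarrow> real) \<Rightarrow> nat \<Rightarrow> nat \<Rightarrow> real" where
  "boundary_G z 0 0 = 0"
| "boundary_G z (Suc i) 0 = boundary_G z i 0 + z (Suc i, 0)"
| "boundary_G z 0 (Suc j) = boundary_G z 0 j + z (0, Suc j)"
| "boundary_G z (Suc i) (Suc j) = max (boundary_G z i (Suc j)) (boundary_G z (Suc i) j) + z (Suc i, Suc j)"

fun boundary_rate :: "(nat \<Rightarrow> real) \<Rightarrow> (nat \<Rightarrow> real) \<Rightarrow> nat \<times> nat \<Rightarrow> real" where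
  "boundary_rate a b (0, 0) = 1"
| "boundary_rate a b (Suc i, 0) = a i"
| "boundary_rate a b (0, Suc j) = b j"
| "boundary_rate a b (Suc i, Suc j) = a i + b j"

definition hor_incr :: "(nat \<times> nat \<Rightarrow> real) \<Rightarrow> nat \<Rightarrow> nat \<Rightarrow> real" where
  "hor_incr z k j = boundary_G z (Suc k) j - boundary_G z k j"

definition ver_incr :: "(nat \<times> nat \<Rightarrow> real) \<Rightarrow> nat \<Rightarrow> nat \<Rightarrow> real" where
  "ver_incr z i l = boundary_G z i (Suc l) - boundary_G z i l"

lemma incr_step:
  "hor_incr z k (Suc j) = z (Suc k, Suc j) + max (hor_incr z k j - ver_incr z k j) 0"
  "ver_incr z (Suc k) j = z (Suc k, Suc j) + max (ver_incr z k j - hor_incr z k j) 0"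
  by (auto simp: hor_incr_def ver_incr_def)

lemma incr_boundary:
  "hor_incr z k 0 = z (Suc k, 0)" "ver_incr z 0 l = z (0, Suc l)"
  by (auto simp: hor_incr_def ver_incr_def)

lemma boundary_G_nonneg:
  assumes "\<forall>p. 0 \<le> z p"
  shows "0 \<le> boundary_G z i j"
  using assms by (induction z i j rule: boundary_G.induct) (auto intro!: add_nonneg_nonneg max.coboundedI1)

lemma G_le_boundary_G:
  assumes z: "\<forall>p. 0 \<le> z p"
  shows "G (\<lambda>(i, j). z (Suc i, Suc j)) m n \<le> boundary_G z m n"
proof (induction m arbitrary: n)
  case 0
  show ?case using boundary_G_nonneg[OF z] by simp
next
  case (Suc m)
  note IH = Suc
  show ?case
  proof (induction n)
    case 0
    show ?case using boundary_G_nonneg[OF z, of "Suc m" 0] by simp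
  next
    case (Suc n)
    then show ?case using IH[of "Suc n"] by auto
  qed
qed

lemma boundary_G_eq_sum:
  "boundary_G z m n = (\<Sum>k<m. hor_incr z k n) + (\<Sum>l<n. z (0, Suc l))"
proof -
  have "boundary_G z 0 n = (\<Sum>l<n. z (0, Suc l))" by (induction n) auto
  moreover have "boundary_G z m n = (\<Sum>k<m. hor_incr z k n) + boundary_G z 0 n"
    by (induction m) (auto simp: hor_incr_def)
  ultimately show ?thesis by simp
qed

text \<open>
  The state of a sweep through the quadrant, row by row and from left to right, in which row \<open>j\<close> has
  been processed up to column \<open>i\<close>. Increments live in the index of the axis edge they project to: the
  index \<open>(Suc k, 0)\<close> holds the horizontal increment in column \<open>k\<close> on the current front, and
  \<open>(0, Suc j)\<close> holds the vertical increment at the current corner. All other indices still hold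
  untouched weights.
\<close>

fun front_incr :: "nat \<Rightarrow> nat \<Rightarrow> nat \<times> nat \<Rightarrow> (nat \<times> nat \<Rightarrow> real) \<Rightarrow> real" where
  "front_incr i j (Suc k, 0) z = hor_incr z k (if k < i then Suc j else j)"
| "front_incr i j (0, Suc l) z = (if l = j then ver_incr z i j else z (0, Suc l))"
| "front_incr i j p z = z p"

text \<open>
  The indices that are still in use when only the columns below \<open>m\<close> are swept. Bounding the columns
  makes each row finite, so that the sweep reaches the next row.
\<close>

definition front_index :: "nat \<Rightarrow> nat \<Rightarrow> nat \<Rightarrow> (nat \<times> nat) set" where
  "front_index m i j = {(Suc k, 0) | k. k < m} \<union> {(0, Suc l) | l. j \<le> l} \<union>
     {(Suc k, Suc l) | k l. k < m \<and> (j < l \<or> l = j \<and> i \<le> k)}"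

definition boundary_law :: "(nat \<Rightarrow> real) \<Rightarrow> (nat \<Rightarrow> real) \<Rightarrow> (nat \<times> nat \<Rightarrow> real) measure" where
  "boundary_law a b = (\<Pi>\<^sub>M p\<in>UNIV. exp_law (boundary_rate a b p))"

lemma boundary_rate_pos:
  assumes "\<And>i. 0 < a i" "\<And>j. 0 < b j"
  shows "0 < boundary_rate a b p"
  by (cases "(a, b, p)" rule: boundary_rate.cases) (auto simp: assms add_pos_pos)

lemma
  assumes pos: "\<And>i. 0 < a i" "\<And>j. 0 < b j"
  shows prob_space_boundary_law: "prob_space (boundary_law a b)"
    and measurable_boundary_law_coord: "(\<lambda>z. z p) \<in> borel_measurable (boundary_law a b)"
    and distr_boundary_law_coord:
      "distr (boundary_law a b) borel (\<lambda>z. z p) = exp_law (boundary_rate a b p)"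
    and AE_boundary_law_nonneg: "AE z in boundary_law a b. \<forall>p. 0 \<le> z p"
proof -
  let ?E = "\<lambda>p. exp_law (boundary_rate a b p)"
  have pr: "prob_space (?E p)" for p
    by (rule prob_space_exponential_density) (rule boundary_rate_pos[OF pos])
  show "prob_space (boundary_law a b)"
    unfolding boundary_law_def by (intro prob_space_PiM pr)
  have "(\<lambda>z. z p) \<in> boundary_law a b \<rightarrow>\<^sub>M ?E p"
    unfolding boundary_law_def by (rule measurable_component_singleton) simp
  then show "(\<lambda>z. z p) \<in> borel_measurable (boundary_law a b)" by simp
  have "distr (boundary_law a b) borel (\<lambda>z. z p) = distr (boundary_law a b) (?E p) (\<lambda>z. z p)"
    by (rule distr_cong) auto
  then show "distr (boundary_law a b) borel (\<lambda>z. z p) = ?E p"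
    unfolding boundary_law_def using distr_PiM_component[of UNIV ?E p] pr by simp
  show "AE z in boundary_law a b. \<forall>p. 0 \<le> z p"
    unfolding AE_all_countable boundary_law_def
  proof
    fix p show "AE z in (\<Pi>\<^sub>M p\<in>UNIV. ?E p). 0 \<le> z p"
      by (rule AE_PiM_component[OF pr]) (auto simp: AE_density exponential_density_def)
  qed
qed

text \<open>
  The front keeps its law throughout the sweep, by induction over the processed corners. Passing to
  the next row only discards the vertical increment at the right end.
\<close>

lemma burke_front:
  assumes pos: "\<And>i. 0 < a i" "\<And>j. 0 < b j"
  defines "N \<equiv> boundary_law a b"
  assumes "i \<le> m"
  shows "prob_space.indep_vars N (\<lambda>_. borel) (front_incr i j) (front_index m i j) \<and>
         (\<forall>p\<in>front_index m i j. distr N borel (front_incr i j p) = exp_law (boundary_rate a b p))"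
proof -
  interpret N: prob_space N
    unfolding N_def by (rule prob_space_boundary_law[OF pos])
  have coord: "(\<lambda>z. z p) \<in> borel_measurable N" for p
    unfolding N_def by (rule measurable_boundary_law_coord[OF pos])
  have coord_law: "distr N borel (\<lambda>z. z p) = exp_law (boundary_rate a b p)" for p
    unfolding N_def by (rule distr_boundary_law_coord[OF pos])
  have base: "N.indep_vars (\<lambda>_. borel) (\<lambda>p z. z p) UNIV"
  proof -
    have "distr N (\<Pi>\<^sub>M p\<in>UNIV. borel) (\<lambda>z. \<lambda>p\<in>UNIV. z p) = distr N N (\<lambda>z. z)"
      unfolding N_def boundary_law_def by (intro distr_cong refl) (auto intro!: sets_PiM_cong)
    then show ?thesis
      by (subst N.indep_vars_iff_distr_eq_PiM)
        (auto simp: coord coord_law N_def[symmetric] boundary_law_def[symmetric])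
  qed
  let ?P = "\<lambda>i j. N.indep_vars (\<lambda>_. borel) (front_incr i j) (front_index m i j) \<and>
         (\<forall>p\<in>front_index m i j. distr N borel (front_incr i j p) = exp_law (boundary_rate a b p))"
  have step: "?P (Suc i) j" if P: "?P i j" and i: "i < m" for i j
  proof -
    let ?p = "(Suc i, 0::nat)" and ?q = "(0::nat, Suc j)" and ?r = "(Suc i, Suc j)"
    have mem: "?p \<in> front_index m i j" "?q \<in> front_index m i j" "?r \<in> front_index m i j"
      using i by (auto simp: front_index_def)
    note st = N.burke_step[where a="a i" and b="b j" and X="front_incr i j" and K="front_index m i j" and p="?p" and q="?q" and r="?r",
        OF pos(1)[of i] pos(2)[of j] conjunct1[OF P] mem]
    have eq: "front_incr (Suc i) j ?p = (\<lambda>z. front_incr i j ?r z + max (front_incr i j ?p z - front_incr i j ?q z) 0)"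
       "front_incr (Suc i) j ?q = (\<lambda>z. front_incr i j ?r z + max (front_incr i j ?q z - front_incr i j ?p z) 0)"
      by (auto simp: incr_step)
    have other: "front_incr (Suc i) j s = front_incr i j s" if "s \<noteq> ?p" "s \<noteq> ?q" for s
    proof
      fix z show "front_incr (Suc i) j s z = front_incr i j s z"
        using that by (cases "(i, j, s, z)" rule: front_incr.cases) auto
    qed
    \<comment> \<open>The flip uses up exactly the weight of the corner.\<close>
    have idx: "front_index m (Suc i) j = front_index m i j - {?r}"
      using i by (auto simp: front_index_def)
    have laws: "distr N borel (front_incr i j ?p) = exp_law (a i)" "distr N borel (front_incr i j ?q) = exp_law (b j)"
      "distr N borel (front_incr i j ?r) = exp_law (a i + b j)"
      using P mem by auto
    note st = st[OF _ _ _ laws, folded eq]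
    have upd: "front_incr (Suc i) j = (front_incr i j)(?p := front_incr (Suc i) j ?p, ?q := front_incr (Suc i) j ?q)"
      using other by (auto simp: fun_eq_iff)
    have "N.indep_vars (\<lambda>_. borel) (front_incr (Suc i) j) (front_index m (Suc i) j)"
      by (subst upd, subst idx) (use st(1) in simp)
    moreover have "distr N borel (front_incr (Suc i) j p) = exp_law (boundary_rate a b p)"
      if "p \<in> front_index m (Suc i) j" for p
    proof -
      consider "p = ?p" | "p = ?q" | "p \<noteq> ?p" "p \<noteq> ?q" by blast
      then show ?thesis
      proof cases
        case 1 then show ?thesis using st(2) by simp
      next
        case 2 then show ?thesis using st(3) by simp
      next
        case 3 then show ?thesis using P that idx by (simp add: other)
      qed
    qed
    ultimately show ?thesis by blast
  qed
  have row: "?P i j" if "?P 0 j" "i \<le> m" for i j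
    using that(2)
  proof (induction i)
    case 0
    show ?case by (rule that(1))
  next
    case (Suc i)
    then show ?case by (intro step) auto
  qed
  have "?P 0 j" for j
  proof (induction j)
    case 0
    have "front_incr 0 0 p = (\<lambda>z. z p)" for p
      by (rule ext, cases "(a, b, p)" rule: boundary_rate.cases) (auto simp: incr_boundary)
    then show ?case
      using N.indep_vars_subset[OF base, of "front_index m 0 0"] by (simp add: coord_law cong: N.indep_vars_cong)
  next
    case (Suc j)
    from row[OF Suc order_refl] have P: "?P m j" .
    have eq: "front_incr 0 (Suc j) p = front_incr m j p" if "p \<in> front_index m 0 (Suc j)" for p
      using that by (auto simp: front_index_def incr_boundary fun_eq_iff)
    have sub: "front_index m 0 (Suc j) \<subseteq> front_index m m j"
      by (auto simp: front_index_def)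
    have "N.indep_vars (\<lambda>_. borel) (front_incr 0 (Suc j)) (front_index m 0 (Suc j))"
      using N.indep_vars_subset[OF conjunct1[OF P] sub] by (simp add: eq cong: N.indep_vars_cong)
    then show ?case using P sub by (auto simp: eq)
  qed
  then show ?thesis using row \<open>i \<le> m\<close> by blast
qed

lemma ennreal_sum_le: "ennreal (\<Sum>i\<in>A. f i) \<le> (\<Sum>i\<in>A. ennreal (f i))"
proof (induction A rule: infinite_finite_induct)
  case (insert x A)
  have "ennreal (f x + (\<Sum>i\<in>A. f i)) \<le> ennreal (max 0 (f x) + max 0 (\<Sum>i\<in>A. f i))"
    by (rule ennreal_leI) auto
  also have "\<dots> = ennreal (f x) + ennreal (\<Sum>i\<in>A. f i)"
    by (subst ennreal_plus) (auto simp: ennreal_max_0)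
  finally show ?case using insert by (auto intro: order_trans add_left_mono)
qed auto

lemma nn_integral_exp_law_id:
  assumes "0 < l"
  shows "(\<integral>\<^sup>+x. ennreal x \<partial>exp_law l) = ennreal (1 / l)"
proof -
  have "(\<integral>\<^sup>+x. ennreal x \<partial>exp_law l) = (\<integral>\<^sup>+x. ennreal (exponential_density l x * x ^ 1) \<partial>lborel)"
    using assms by (subst nn_integral_exp_law) (auto intro!: nn_integral_cong simp: ennreal_mult' exponential_density_nonneg)
  also have "\<dots> = ennreal (1 / l)"
    using nn_integral_erlang_ith_moment[OF assms, of 0 1] by simp
  finally show ?thesis .
qed

lemma measurable_G [measurable]: "(\<lambda>w. G w m n) \<in> borel_measurable weight_space"
proof (induction m arbitrary: n)
  case (Suc m)
  show ?case
  proof (induction n)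
    case (Suc n)
    have [measurable]: "(\<lambda>w. w (m, n)) \<in> borel_measurable weight_space"
      unfolding weight_space_def by measurable
    note [measurable] = Suc \<open>(\<lambda>w. G w m (Suc n)) \<in> borel_measurable weight_space\<close>
    show ?case by simp
  qed simp
qed simp

text \<open>
  The passage time with boundary is a sum of increments along the left side and then along the top of
  the rectangle, each of which has an exponential law of known rate.
\<close>

lemma quenched_upper_bound:
  assumes pos: "\<And>i. 0 < a i" "\<And>j. 0 < b j"
  shows "(\<integral>\<^sup>+w. ennreal (G w m n) \<partial>quenched_law (a, b)) \<le>
    (\<Sum>i<m. ennreal (1 / a i)) + (\<Sum>j<n. ennreal (1 / b j))"
proof -
  define N where "N = boundary_law a b"
  interpret N: prob_space N
    unfolding N_def by (rule prob_space_boundary_law[OF pos])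
  have coord [measurable]: "(\<lambda>z. z p) \<in> borel_measurable N" for p
    unfolding N_def by (rule measurable_boundary_law_coord[OF pos])
  let ?f = "\<lambda>(i, j). (Suc i, Suc j)"
  let ?s = "\<lambda>z :: nat \<times> nat \<Rightarrow> real. \<lambda>(i, j). z (Suc i, Suc j)"
  have q: "quenched_law (a, b) = (\<Pi>\<^sub>M p\<in>UNIV. exp_law (boundary_rate a b (?f p)))"
    unfolding quenched_law_def by (auto intro!: PiM_cong)
  also have "\<dots> = distr N (\<Pi>\<^sub>M p\<in>UNIV. exp_law (boundary_rate a b (?f p))) (\<lambda>z. \<lambda>p\<in>UNIV. z (?f p))"
    unfolding N_def boundary_law_def
    by (rule distr_PiM_reindex[symmetric])
      (auto simp: inj_on_def intro!: prob_space_exponential_density boundary_rate_pos pos)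
  also have "\<dots> = distr N weight_space ?s"
    unfolding weight_space_def by (intro distr_cong refl sets_PiM_cong) auto
  finally have qd: "quenched_law (a, b) = distr N weight_space ?s" .
  have s: "?s \<in> N \<rightarrow>\<^sub>M weight_space"
    unfolding weight_space_def by (rule measurable_PiM_single') (auto simp: split_beta)
  have bf: "prob_space.indep_vars N (\<lambda>_. borel) (front_incr 0 n) (front_index m 0 n)"
    "\<And>p. p \<in> front_index m 0 n \<Longrightarrow> distr N borel (front_incr 0 n p) = exp_law (boundary_rate a b p)"
    using burke_front[where a=a and b=b and i=0 and m=m and j=n, OF pos] by (auto simp: N_def)
  have hm [measurable]: "(\<lambda>z. hor_incr z k n) \<in> borel_measurable N" and hl: "distr N borel (\<lambda>z. hor_incr z k n) = exp_law (a k)" if "k < m" for k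
  proof -
    have mem: "(Suc k, 0) \<in> front_index m 0 n" using that by (auto simp: front_index_def)
    have eq: "front_incr 0 n (Suc k, 0) = (\<lambda>z. hor_incr z k n)" by auto
    show "(\<lambda>z. hor_incr z k n) \<in> borel_measurable N"
      using bf(1) mem by (auto simp: N.indep_vars_def2 eq[symmetric])
    show "distr N borel (\<lambda>z. hor_incr z k n) = exp_law (a k)"
      using bf(2)[OF mem] by (simp add: eq)
  qed
  have h: "(\<integral>\<^sup>+z. ennreal (hor_incr z k n) \<partial>N) = ennreal (1 / a k)" if "k < m" for k
  proof -
    have "(\<integral>\<^sup>+z. ennreal (hor_incr z k n) \<partial>N) = (\<integral>\<^sup>+x. ennreal x \<partial>distr N borel (\<lambda>z. hor_incr z k n))"
      using hm[OF that] by (subst nn_integral_distr) auto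
    then show ?thesis by (simp add: hl[OF that] nn_integral_exp_law_id pos)
  qed
  have coord_int: "(\<integral>\<^sup>+z. ennreal (z p) \<partial>N) = ennreal (1 / boundary_rate a b p)" for p
  proof -
    have "(\<integral>\<^sup>+z. ennreal (z p) \<partial>N) = (\<integral>\<^sup>+x. ennreal x \<partial>distr N borel (\<lambda>z. z p))"
      by (rule nn_integral_distr[symmetric]) auto
    also have "\<dots> = ennreal (1 / boundary_rate a b p)"
      unfolding N_def distr_boundary_law_coord[OF pos]
      by (intro nn_integral_exp_law_id boundary_rate_pos pos)
    finally show ?thesis .
  qed
  have nonneg: "AE z in N. \<forall>p. 0 \<le> z p"
    unfolding N_def by (rule AE_boundary_law_nonneg[OF pos])
  have "(\<integral>\<^sup>+w. ennreal (G w m n) \<partial>quenched_law (a, b)) = (\<integral>\<^sup>+z. ennreal (G (?s z) m n) \<partial>N)"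
    unfolding qd by (rule nn_integral_distr[OF s]) measurable
  also have "\<dots> \<le> (\<integral>\<^sup>+z. (\<Sum>k<m. ennreal (hor_incr z k n)) + (\<Sum>l<n. ennreal (z (0, Suc l))) \<partial>N)"
  proof (rule nn_integral_mono_AE)
    show "AE z in N. ennreal (G (?s z) m n) \<le> (\<Sum>k<m. ennreal (hor_incr z k n)) + (\<Sum>l<n. ennreal (z (0, Suc l)))"
      using nonneg
    proof eventually_elim
      case (elim z)
      have "ennreal (G (?s z) m n) \<le> ennreal ((\<Sum>k<m. hor_incr z k n) + (\<Sum>l<n. z (0, Suc l)))"
        using G_le_boundary_G[of z m n] elim by (auto simp: boundary_G_eq_sum intro: ennreal_leI)
      also have "\<dots> \<le> ennreal (\<Sum>k<m. hor_incr z k n) + ennreal (\<Sum>l<n. z (0, Suc l))"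
        using ennreal_sum_le[of "\<lambda>b. if b then (\<Sum>k<m. hor_incr z k n) else (\<Sum>l<n. z (0, Suc l))" UNIV]
        by (simp add: UNIV_bool add.commute)
      also have "\<dots> \<le> (\<Sum>k<m. ennreal (hor_incr z k n)) + (\<Sum>l<n. ennreal (z (0, Suc l)))"
        by (intro add_mono ennreal_sum_le)
      finally show ?case .
    qed
  qed
  also have "\<dots> = (\<Sum>k<m. \<integral>\<^sup>+z. ennreal (hor_incr z k n) \<partial>N) + (\<Sum>l<n. \<integral>\<^sup>+z. ennreal (z (0, Suc l)) \<partial>N)"
  proof (subst nn_integral_add)
    have hm': "(\<lambda>z. ennreal (hor_incr z k n)) \<in> borel_measurable N" if "k < m" for k
      using hm[OF that] by measurable
    then show "(\<lambda>z. \<Sum>k<m. ennreal (hor_incr z k n)) \<in> borel_measurable N"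
      by (intro borel_measurable_sum) auto
    have "(\<integral>\<^sup>+z. (\<Sum>k<m. ennreal (hor_incr z k n)) \<partial>N) = (\<Sum>k<m. \<integral>\<^sup>+z. ennreal (hor_incr z k n) \<partial>N)"
      using hm' by (intro nn_integral_sum) auto
    then show "(\<integral>\<^sup>+z. (\<Sum>k<m. ennreal (hor_incr z k n)) \<partial>N) + (\<integral>\<^sup>+z. (\<Sum>l<n. ennreal (z (0, Suc l))) \<partial>N) =
        (\<Sum>k<m. \<integral>\<^sup>+z. ennreal (hor_incr z k n) \<partial>N) + (\<Sum>l<n. \<integral>\<^sup>+z. ennreal (z (0, Suc l)) \<partial>N)"
      by (simp add: nn_integral_sum)
  qed measurable
  also have "\<dots> = (\<Sum>i<m. ennreal (1 / a i)) + (\<Sum>j<n. ennreal (1 / b j))"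
    by (simp add: h coord_int)
  finally show ?thesis .
qed

section \<open>Stationarity and ergodicity of the environment\<close>

text \<open>
  The shifts with equal parameters in both coordinates suffice, and they form a semigroup.
\<close>

definition diag_shift :: "nat \<Rightarrow> (nat \<Rightarrow> real) \<times> (nat \<Rightarrow> real) \<Rightarrow> (nat \<Rightarrow> real) \<times> (nat \<Rightarrow> real)" where
  "diag_shift k = map_prod (shift k) (shift k)"

lemma diag_shift_apply [simp]:
  "fst (diag_shift k \<omega>) i = fst \<omega> (i + k)" "snd (diag_shift k \<omega>) i = snd \<omega> (i + k)"
  by (auto simp: diag_shift_def shift_def split_beta)

lemma diag_shift_diag_shift [simp]: "diag_shift k (diag_shift l \<omega>) = diag_shift (k + l) \<omega>"
  by (auto simp: diag_shift_def shift_def prod_eq_iff fun_eq_iff add.assoc)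

locale ergodic_environment =
  fixes \<mu> :: "((nat \<Rightarrow> real) \<times> (nat \<Rightarrow> real)) measure"
  assumes env: "environment \<mu>"
begin

sublocale prob_space \<mu>
  using env by (simp add: environment_def)

lemma sets_env [measurable_cong]: "sets \<mu> = sets env_space"
  using env by (simp add: environment_def)

lemma space_env: "space \<mu> = {c. \<forall>n. 0 < c n} \<times> {c. \<forall>n. 0 < c n}"
  using sets_eq_imp_space_eq[OF sets_env] by (simp add: space_env_space)

lemma env_pos: "\<omega> \<in> space \<mu> \<Longrightarrow> 0 < fst \<omega> i" "\<omega> \<in> space \<mu> \<Longrightarrow> 0 < snd \<omega> i"
  by (auto simp: space_env)

lemma measurable_env [measurable]:
  "(\<lambda>\<omega>. fst \<omega> i) \<in> borel_measurable \<mu>" "(\<lambda>\<omega>. snd \<omega> i) \<in> borel_measurable \<mu>"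
proof -
  have "(\<lambda>\<omega>. fst \<omega> i) \<in> borel_measurable env_space" "(\<lambda>\<omega>. snd \<omega> i) \<in> borel_measurable env_space"
    unfolding env_space_def
    by (rule measurable_compose[OF measurable_fst measurable_seq_space_component],
        rule measurable_compose[OF measurable_snd measurable_seq_space_component])
  then show "(\<lambda>\<omega>. fst \<omega> i) \<in> borel_measurable \<mu>" "(\<lambda>\<omega>. snd \<omega> i) \<in> borel_measurable \<mu>"
    by measurable
qed

lemma diag_shift_measurable [measurable]: "diag_shift k \<in> \<mu> \<rightarrow>\<^sub>M \<mu>"
  and distr_diag_shift: "distr \<mu> \<mu> (diag_shift k) = \<mu>"
proof -
  have "diag_shift k \<in> \<mu> \<rightarrow>\<^sub>M \<mu> \<and> distr \<mu> \<mu> (diag_shift k) = \<mu>"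
  proof (cases "k = 0")
    case True
    then have "diag_shift k = (\<lambda>x. x)"
      by (auto simp: diag_shift_def shift_def fun_eq_iff)
    then show ?thesis by (simp add: distr_id)
  next
    case False
    then show ?thesis
      using env by (auto simp: environment_def stationary_under_def diag_shift_def)
  qed
  then show "diag_shift k \<in> \<mu> \<rightarrow>\<^sub>M \<mu>" "distr \<mu> \<mu> (diag_shift k) = \<mu>" by auto
qed

lemma nn_integral_diag_shift:
  "f \<in> borel_measurable \<mu> \<Longrightarrow> (\<integral>\<^sup>+\<omega>. f (diag_shift k \<omega>) \<partial>\<mu>) = (\<integral>\<^sup>+\<omega>. f \<omega> \<partial>\<mu>)"
  using nn_integral_distr[OF diag_shift_measurable[of k], of f] by (simp add: distr_diag_shift)

lemma emeasure_diag_shift: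
  assumes "A \<in> sets \<mu>"
  shows "emeasure \<mu> {\<omega> \<in> space \<mu>. diag_shift k \<omega> \<in> A} = emeasure \<mu> A"
proof -
  have "emeasure \<mu> A = emeasure (distr \<mu> \<mu> (diag_shift k)) A"
    by (simp add: distr_diag_shift)
  also have "\<dots> = emeasure \<mu> (diag_shift k -` A \<inter> space \<mu>)"
    using assms by (intro emeasure_distr) auto
  also have "diag_shift k -` A \<inter> space \<mu> = {\<omega> \<in> space \<mu>. diag_shift k \<omega> \<in> A}" by auto
  finally show ?thesis ..
qed

text \<open>
  The event is contained in its preimage under the shift but need not be equal to it, so ergodicity is
  applied to the invariant event that \<open>f\<close> is eventually at least \<open>d\<close>. By stationarity the latter is an
  increasing union of events of the same probability, hence not more likely than the former.
\<close>

lemma never_small_null: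
  fixes f :: "(nat \<Rightarrow> real) \<times> (nat \<Rightarrow> real) \<Rightarrow> real"
  assumes f [measurable]: "f \<in> borel_measurable \<mu>"
    and pos: "emeasure \<mu> {\<omega> \<in> space \<mu>. f \<omega> < d} > 0"
  shows "emeasure \<mu> {\<omega> \<in> space \<mu>. \<forall>i. d \<le> f (diag_shift i \<omega>)} = 0"
proof -
  have sp: "diag_shift k \<omega> \<in> space \<mu>" if "\<omega> \<in> space \<mu>" for k \<omega>
    using measurable_space[OF diag_shift_measurable that] .
  define A where "A = {\<omega> \<in> space \<mu>. \<forall>i. d \<le> f (diag_shift i \<omega>)}"
  define B where "B k = {\<omega> \<in> space \<mu>. \<forall>i\<ge>k. d \<le> f (diag_shift i \<omega>)}" for k
  have A [measurable]: "A \<in> sets \<mu>" unfolding A_def by measurable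
  have Bm [measurable]: "B k \<in> sets \<mu>" for k unfolding B_def by measurable
  have B: "B k = {\<omega> \<in> space \<mu>. diag_shift k \<omega> \<in> A}" for k
  proof -
    have "(\<forall>i\<ge>k. d \<le> f (diag_shift i \<omega>)) \<longleftrightarrow> (\<forall>i. d \<le> f (diag_shift (i + k) \<omega>))" for \<omega>
      by (metis le_add2 le_add_diff_inverse2)
    then show ?thesis by (auto simp: A_def B_def sp)
  qed
  have eB: "emeasure \<mu> (B k) = emeasure \<mu> A" for k
    unfolding B by (rule emeasure_diag_shift[OF A])
  have "incseq B" by (auto simp: incseq_def B_def)
  then have "(\<lambda>k. emeasure \<mu> (B k)) \<longlonglongrightarrow> emeasure \<mu> (\<Union>k. B k)"
    by (intro Lim_emeasure_incseq) auto
  then have eq: "emeasure \<mu> (\<Union>k. B k) = emeasure \<mu> A"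
    unfolding eB by (simp add: LIMSEQ_const_iff)
  have "diag_shift 1 -` (\<Union>k. B k) \<inter> space \<mu> = (\<Union>k. B k)"
  proof -
    have "diag_shift 1 \<omega> \<in> (\<Union>k. B k) \<longleftrightarrow> \<omega> \<in> (\<Union>k. B k)" if "\<omega> \<in> space \<mu>" for \<omega>
    proof
      assume "diag_shift 1 \<omega> \<in> (\<Union>k. B k)"
      then obtain k where k: "\<forall>i\<ge>k. d \<le> f (diag_shift (i + 1) \<omega>)" by (auto simp: B_def)
      have "\<forall>i\<ge>Suc k. d \<le> f (diag_shift i \<omega>)"
      proof (intro allI impI)
        fix i assume "Suc k \<le> i"
        then show "d \<le> f (diag_shift i \<omega>)" using k[rule_format, of "i - 1"] by auto
      qed
      then show "\<omega> \<in> (\<Union>k. B k)" using that by (auto simp: B_def)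
    next
      assume "\<omega> \<in> (\<Union>k. B k)"
      then obtain k where k: "\<forall>i\<ge>k. d \<le> f (diag_shift i \<omega>)" by (auto simp: B_def)
      then have "diag_shift 1 \<omega> \<in> B k" using sp[OF that] by (auto simp: B_def)
      then show "diag_shift 1 \<omega> \<in> (\<Union>k. B k)" by blast
    qed
    moreover have "(\<Union>k. B k) \<subseteq> space \<mu>" by (auto simp: B_def)
    ultimately show ?thesis by blast
  qed
  moreover have "ergodic_under \<mu> (diag_shift 1)"
    using env by (auto simp: environment_def diag_shift_def)
  ultimately have "emeasure \<mu> A = 0 \<or> emeasure \<mu> A = 1"
    unfolding eq[symmetric] ergodic_under_def by auto
  moreover have "emeasure \<mu> A \<noteq> 1"
  proof
    assume "emeasure \<mu> A = 1"
    then have "emeasure \<mu> (space \<mu> - A) = 0"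
      using emeasure_compl[OF A] by (simp add: emeasure_space_1)
    moreover have "{\<omega> \<in> space \<mu>. f \<omega> < d} \<subseteq> space \<mu> - A"
    proof (safe)
      fix \<omega> assume "f \<omega> < d" "\<omega> \<in> A"
      moreover have "diag_shift 0 \<omega> = \<omega>" by (auto simp: diag_shift_def shift_def prod_eq_iff)
      ultimately show False by (auto simp: A_def not_le dest: spec[of _ 0])
    qed
    then have "emeasure \<mu> {\<omega> \<in> space \<mu>. f \<omega> < d} \<le> emeasure \<mu> (space \<mu> - A)"
      by (intro emeasure_mono) auto
    ultimately show False using pos by simp
  qed
  ultimately show ?thesis by (simp add: A_def)
qed

lemma avoid_window_tendsto_0:
  fixes f :: "(nat \<Rightarrow> real) \<times> (nat \<Rightarrow> real) \<Rightarrow> real"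
  assumes f [measurable]: "f \<in> borel_measurable \<mu>"
    and pos: "emeasure \<mu> {\<omega> \<in> space \<mu>. f \<omega> < d} > 0"
  shows "(\<lambda>N. emeasure \<mu> {\<omega> \<in> space \<mu>. \<forall>i<N. d \<le> f (diag_shift i \<omega>)}) \<longlonglongrightarrow> 0"
proof -
  let ?A = "\<lambda>N. {\<omega> \<in> space \<mu>. \<forall>i<N. d \<le> f (diag_shift i \<omega>)}"
  have "(\<lambda>N. emeasure \<mu> (?A N)) \<longlonglongrightarrow> emeasure \<mu> (\<Inter>N. ?A N)"
    by (rule Lim_emeasure_decseq) (auto simp: decseq_def)
  also have "(\<Inter>N. ?A N) = {\<omega> \<in> space \<mu>. \<forall>i. d \<le> f (diag_shift i \<omega>)}"
    by auto
  finally show ?thesis by (simp add: never_small_null[OF f pos])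
qed

text \<open>
  A point of the support below \<open>d\<close> has the half-line below \<open>d\<close> as a neighbourhood.
\<close>

lemma left_endpoint_less:
  assumes f [measurable]: "f \<in> borel_measurable \<mu>" and "left_endpoint (distr \<mu> borel f) < ereal d"
  shows "emeasure \<mu> {\<omega> \<in> space \<mu>. f \<omega> < d} > 0"
proof -
  obtain x where x: "x \<in> measure_support (distr \<mu> borel f)" "x < d"
    using assms(2) by (auto simp: left_endpoint_def Inf_less_iff)
  from x(1) have "open {..<d} \<and> x \<in> {..<d} \<longrightarrow> emeasure (distr \<mu> borel f) {..<d} > 0"
    unfolding measure_support_def mem_Collect_eq by (rule spec)
  with x(2) have "emeasure (distr \<mu> borel f) {..<d} > 0" by simp
  also have "emeasure (distr \<mu> borel f) {..<d} = emeasure \<mu> (f -` {..<d} \<inter> space \<mu>)"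
    by (rule emeasure_distr) auto
  also have "f -` {..<d} \<inter> space \<mu> = {\<omega> \<in> space \<mu>. f \<omega> < d}" by auto
  finally show ?thesis .
qed

lemma measurable_quenched [measurable]: "quenched_law \<in> \<mu> \<rightarrow>\<^sub>M subprob_algebra weight_space"
  using measurable_prob_algebraD[OF measurable_quenched_law] by (simp add: measurable_cong_sets[OF sets_env refl])

lemma sets_annealed [measurable_cong]: "sets (annealed_law \<mu>) = sets weight_space"
  unfolding annealed_law_def
  by (rule sets_bind[OF sets_kernel[OF measurable_quenched] not_empty])

lemma nn_integral_annealed:
  assumes "f \<in> borel_measurable weight_space"
  shows "(\<integral>\<^sup>+w. f w \<partial>annealed_law \<mu>) = (\<integral>\<^sup>+\<omega>. \<integral>\<^sup>+w. f w \<partial>quenched_law \<omega> \<partial>\<mu>)"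
  unfolding annealed_law_def by (rule nn_integral_bind[OF assms measurable_quenched])

lemma prob_space_annealed: "prob_space (annealed_law \<mu>)"
proof
  have "prob_space (quenched_law \<omega>)" "sets (quenched_law \<omega>) = sets weight_space" if "\<omega> \<in> space \<mu>" for \<omega>
  proof -
    have "\<omega> \<in> space env_space" using that sets_eq_imp_space_eq[OF sets_env] by simp
    from measurable_space[OF measurable_quenched_law this]
    show "prob_space (quenched_law \<omega>)" "sets (quenched_law \<omega>) = sets weight_space"
      by (auto simp: space_prob_algebra)
  qed
  then have "emeasure (quenched_law \<omega>) (space weight_space) = 1" if "\<omega> \<in> space \<mu>" for \<omega>
    using that by (metis prob_space.emeasure_space_1 sets_eq_imp_space_eq)
  then have "(\<integral>\<^sup>+\<omega>. emeasure (quenched_law \<omega>) (space weight_space) \<partial>\<mu>) = (\<integral>\<^sup>+\<omega>. 1 \<partial>\<mu>)"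
    by (intro nn_integral_cong) auto
  then show "emeasure (annealed_law \<mu>) (space (annealed_law \<mu>)) = 1"
    using emeasure_annealed_law[OF env, of "space weight_space"] sets_eq_imp_space_eq[OF sets_annealed]
    by (simp add: emeasure_space_1)
qed

lemma nn_integral_env_coord:
  fixes h :: "real \<Rightarrow> ennreal"
  assumes [measurable]: "h \<in> borel_measurable borel"
  shows "(\<integral>\<^sup>+\<omega>. h (fst \<omega> i) \<partial>\<mu>) = (\<integral>\<^sup>+\<omega>. h (fst \<omega> 0) \<partial>\<mu>)"
    and "(\<integral>\<^sup>+\<omega>. h (snd \<omega> i) \<partial>\<mu>) = (\<integral>\<^sup>+\<omega>. h (snd \<omega> 0) \<partial>\<mu>)"
proof -
  have "(\<lambda>\<omega>. h (fst \<omega> 0)) \<in> borel_measurable \<mu>" "(\<lambda>\<omega>. h (snd \<omega> 0)) \<in> borel_measurable \<mu>"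
    by measurable
  from this[THEN nn_integral_diag_shift, of i]
  show "(\<integral>\<^sup>+\<omega>. h (fst \<omega> i) \<partial>\<mu>) = (\<integral>\<^sup>+\<omega>. h (fst \<omega> 0) \<partial>\<mu>)"
    and "(\<integral>\<^sup>+\<omega>. h (snd \<omega> i) \<partial>\<mu>) = (\<integral>\<^sup>+\<omega>. h (snd \<omega> 0) \<partial>\<mu>)"
    by (simp_all only: diag_shift_apply add_0)
qed

lemma annealed_upper_bound:
  "(\<integral>\<^sup>+w. ennreal (G w m n) \<partial>annealed_law \<mu>) \<le>
    of_nat m * (\<integral>\<^sup>+\<omega>. ennreal (1 / fst \<omega> 0) \<partial>\<mu>) + of_nat n * (\<integral>\<^sup>+\<omega>. ennreal (1 / snd \<omega> 0) \<partial>\<mu>)"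
proof -
  have "(\<integral>\<^sup>+w. ennreal (G w m n) \<partial>annealed_law \<mu>) = (\<integral>\<^sup>+\<omega>. \<integral>\<^sup>+w. ennreal (G w m n) \<partial>quenched_law \<omega> \<partial>\<mu>)"
    by (rule nn_integral_annealed) measurable
  also have "\<dots> \<le> (\<integral>\<^sup>+\<omega>. (\<Sum>i<m. ennreal (1 / fst \<omega> i)) + (\<Sum>j<n. ennreal (1 / snd \<omega> j)) \<partial>\<mu>)"
  proof (rule nn_integral_mono)
    fix \<omega> assume "\<omega> \<in> space \<mu>"
    then show "(\<integral>\<^sup>+w. ennreal (G w m n) \<partial>quenched_law \<omega>) \<le> (\<Sum>i<m. ennreal (1 / fst \<omega> i)) + (\<Sum>j<n. ennreal (1 / snd \<omega> j))"
      using quenched_upper_bound[of "fst \<omega>" "snd \<omega>"] env_pos by simp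
  qed
  also have "\<dots> = (\<Sum>i<m. \<integral>\<^sup>+\<omega>. ennreal (1 / fst \<omega> i) \<partial>\<mu>) + (\<Sum>j<n. \<integral>\<^sup>+\<omega>. ennreal (1 / snd \<omega> j) \<partial>\<mu>)"
    by (subst nn_integral_add) (auto simp: nn_integral_sum)
  also have "\<dots> = (\<Sum>i<m. \<integral>\<^sup>+\<omega>. ennreal (1 / fst \<omega> 0) \<partial>\<mu>) + (\<Sum>j<n. \<integral>\<^sup>+\<omega>. ennreal (1 / snd \<omega> 0) \<partial>\<mu>)"
    by (intro arg_cong2[where f="(+)"] sum.cong refl nn_integral_env_coord[where h="\<lambda>x. ennreal (1 / x)"]) measurable
  finally show ?thesis by simp
qed

end

section \<open>Lower bound along one row and one column\<close>

text \<open>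
  Scaling reduces the rate \<open>l\<close> to rate 1 and gives monotonicity in the rate. The cost of truncation is
  controlled by \<open>x \<le> min x M + x\<^sup>2 / (4 * M)\<close>, which is the inequality \<open>0 \<le> (x - 2 * M)\<^sup>2\<close> where
  \<open>x > M\<close>, together with the second moment.
\<close>

lemma nn_integral_exp_law_min_lower:
  assumes l: "0 < l" "l \<le> c" and d: "0 < d" "d \<le> c" and M: "0 < M"
  shows "ennreal (1 / c) \<le> (\<integral>\<^sup>+x. ennreal (min x M) \<partial>exp_law l) + ennreal (1 / (2 * M * d\<^sup>2))"
proof -
  let ?r = "\<lambda>x. ennreal (exponential_density 1 x)"
  have c: "0 < c" using l by simp
  have mom: "(\<integral>\<^sup>+y. ?r y * ennreal (k * y ^ i) \<partial>lborel) = ennreal k * ennreal (fact i)" if "0 \<le> k" for k i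
  proof -
    have "(\<integral>\<^sup>+y. ?r y * ennreal (k * y ^ i) \<partial>lborel) = (\<integral>\<^sup>+y. ennreal k * ennreal (exponential_density 1 y * y ^ i) \<partial>lborel)"
      using that by (intro nn_integral_cong)
        (simp add: ennreal_mult'[symmetric] exponential_density_nonneg ac_simps)
    also have "\<dots> = ennreal k * ennreal (fact i)"
      using nn_integral_erlang_ith_moment[of 1 0 i] by (simp add: nn_integral_cmult)
    finally show ?thesis .
  qed
  have pw: "ennreal (y / c) \<le> ennreal (min (y / c) M) + ennreal (1 / (4 * M * c\<^sup>2) * y\<^sup>2)" for y
  proof (cases "0 \<le> y")
    case True
    define x where "x = y / c"
    have x: "0 \<le> x" using True c by (simp add: x_def)
    have "4 * M * x \<le> 4 * M\<^sup>2 + x\<^sup>2"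
      using zero_le_power2[of "x - 2 * M"] by (simp add: power2_diff power_mult_distrib ac_simps)
    then have "x \<le> M + x\<^sup>2 / (4 * M)"
      using M by (simp add: field_simps power2_eq_square)
    moreover have "0 \<le> x\<^sup>2 / (4 * M)" using M by simp
    ultimately have "x \<le> min x M + x\<^sup>2 / (4 * M)" by linarith
    moreover have "x\<^sup>2 / (4 * M) = 1 / (4 * M * c\<^sup>2) * y\<^sup>2" by (simp add: x_def power_divide)
    ultimately have "ennreal (y / c) \<le> ennreal (min (y / c) M + 1 / (4 * M * c\<^sup>2) * y\<^sup>2)"
      by (simp add: x_def ennreal_leI)
    also have "\<dots> = ennreal (min (y / c) M) + ennreal (1 / (4 * M * c\<^sup>2) * y\<^sup>2)"
      using x M by (intro ennreal_plus) (auto simp: x_def)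
    finally show ?thesis .
  next
    case False
    then have "y / c \<le> 0" using c by (simp add: divide_le_0_iff)
    then show ?thesis by (simp add: ennreal_neg)
  qed
  have "ennreal (1 / c) = (\<integral>\<^sup>+y. ?r y * ennreal (1 / c * y ^ 1) \<partial>lborel)"
    using c by (subst mom) auto
  also have "\<dots> \<le> (\<integral>\<^sup>+y. ?r y * ennreal (min (y / c) M) + ?r y * ennreal (1 / (4 * M * c\<^sup>2) * y\<^sup>2) \<partial>lborel)"
    using pw by (intro nn_integral_mono) (simp add: distrib_left[symmetric] mult_left_mono)
  also have "\<dots> = (\<integral>\<^sup>+y. ?r y * ennreal (min (y / c) M) \<partial>lborel) +
      (\<integral>\<^sup>+y. ?r y * ennreal (1 / (4 * M * c\<^sup>2) * y\<^sup>2) \<partial>lborel)"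
    by (rule nn_integral_add) measurable
  also have "(\<integral>\<^sup>+y. ?r y * ennreal (1 / (4 * M * c\<^sup>2) * y\<^sup>2) \<partial>lborel) = ennreal (1 / (4 * M * c\<^sup>2)) * ennreal (fact 2)"
    using M by (intro mom) auto
  also have "ennreal (1 / (4 * M * c\<^sup>2)) * ennreal (fact 2) = ennreal (1 / (2 * M * c\<^sup>2))"
  proof -
    have "ennreal (1 / (4 * M * c\<^sup>2)) * ennreal (fact 2) = ennreal (1 / (4 * M * c\<^sup>2) * 2)"
      using M by (subst ennreal_mult) auto
    then show ?thesis by (simp add: mult.assoc)
  qed
  also have "(\<integral>\<^sup>+y. ?r y * ennreal (min (y / c) M) \<partial>lborel) \<le> (\<integral>\<^sup>+y. ?r y * ennreal (min (y / l) M) \<partial>lborel)"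
  proof (rule nn_integral_mono)
    fix y show "?r y * ennreal (min (y / c) M) \<le> ?r y * ennreal (min (y / l) M)"
    proof (cases "y < 0")
      case False
      then have "y / c \<le> y / l" using l by (intro divide_left_mono) auto
      then show ?thesis by (intro mult_left_mono ennreal_leI) auto
    qed (simp add: exponential_density_def)
  qed
  also have "(\<integral>\<^sup>+y. ?r y * ennreal (min (y / l) M) \<partial>lborel) =
    ennreal \<bar>1 / l\<bar> * (\<integral>\<^sup>+y. ennreal (exponential_density l (0 + 1 / l * y)) * ennreal (min (0 + 1 / l * y) M) \<partial>lborel)"
  proof -
    have "?r y = ennreal \<bar>1 / l\<bar> * ennreal (exponential_density l (y / l))" for y
      using l by (subst ennreal_mult[symmetric]) (auto simp: exponential_density_def field_simps)
    then show ?thesis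
      by (subst nn_integral_cmult[symmetric]) (auto intro!: nn_integral_cong simp: mult.assoc)
  qed
  also have "\<dots> = (\<integral>\<^sup>+x. ennreal (min x M) \<partial>exp_law l)"
    using l by (subst nn_integral_exp_law, measurable, subst (2) nn_integral_real_affine[where c="1 / l" and t=0]) auto
  also have "ennreal (1 / (2 * M * c\<^sup>2)) \<le> ennreal (1 / (2 * M * d\<^sup>2))"
    using d M by (intro ennreal_leI divide_left_mono mult_left_mono power_mono) auto
  finally show ?thesis by (simp add: add_left_mono)
qed

lemma G_mono_Suc:
  assumes "\<forall>p. 0 \<le> w p"
  shows "G w m n \<le> G w (Suc m) n" "G w m n \<le> G w m (Suc n)"
proof -
  show "G w m n \<le> G w (Suc m) n"
  proof (cases n)
    case 0
    then show ?thesis by (cases m) auto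
  next
    case (Suc k)
    then show ?thesis using assms by (simp add: add_increasing2)
  qed
  show "G w m n \<le> G w m (Suc n)"
    using assms by (cases m) (auto simp: add_increasing2)
qed

lemma G_mono:
  assumes w: "\<forall>p. 0 \<le> w p" and le: "m \<le> m'" "n \<le> n'"
  shows "G w m n \<le> G w m' n'"
proof -
  have "G w m n \<le> G w m' n" using G_mono_Suc(1)[OF w] le(1) by (rule lift_Suc_mono_le)
  also have "\<dots> \<le> G w m' n'" using G_mono_Suc(2)[OF w] le(2) by (rule lift_Suc_mono_le)
  finally show ?thesis .
qed

text \<open>
  The path follows row \<open>J\<close> up to column \<open>I\<close> and then climbs in column \<open>I\<close>. Only its weights outside
  the rectangle of rows below \<open>N\<close> and columns from \<open>m'\<close> on are counted, which makes the
  ranges of summation independent of \<open>I\<close> and \<open>J\<close>.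
\<close>

lemma G_ge_row_then_column:
  assumes w: "\<forall>p. 0 \<le> w p" and "J < N" "N \<le> n" "m' \<le> I" "I < m"
  shows "(\<Sum>i<m'. w (i, J)) + (\<Sum>j\<in>{N..<n}. w (I, j)) \<le> G w m n"
proof -
  have "(\<Sum>i<k. w (i, J)) \<le> G w k (Suc J)" for k
    by (induction k) auto
  then have "(\<Sum>i<m'. w (i, J)) \<le> G w m' (Suc J)" .
  also have "\<dots> \<le> G w (Suc I) N"
    using assms by (intro G_mono) auto
  finally have row: "(\<Sum>i<m'. w (i, J)) \<le> G w (Suc I) N" .
  have "G w (Suc I) N + (\<Sum>j\<in>{N..<n}. w (I, j)) \<le> G w (Suc I) n"
    using \<open>N \<le> n\<close> by (induction n rule: dec_induct) auto
  also have "\<dots> \<le> G w m n"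
    using assms by (intro G_mono) auto
  finally show ?thesis using row by linarith
qed

lemma
  assumes pos: "\<And>i. 0 < a i" "\<And>j. 0 < b j"
  shows nn_integral_quenched_coord: "h \<in> borel_measurable borel \<Longrightarrow>
      (\<integral>\<^sup>+w. h (w (i, j)) \<partial>quenched_law (a, b)) = (\<integral>\<^sup>+x. h x \<partial>exp_law (a i + b j))"
    and AE_quenched_nonneg: "AE w in quenched_law (a, b). \<forall>p. 0 \<le> w p"
    and measurable_quenched_coord: "(\<lambda>w. w p) \<in> borel_measurable (quenched_law (a, b))"
proof -
  let ?D = "\<lambda>(i, j). exp_law (a i + b j)"
  have pr: "prob_space (?D p)" for p
    by (auto simp: split_beta pos add_pos_pos intro!: prob_space_exponential_density)
  have q: "quenched_law (a, b) = Pi\<^sub>M UNIV ?D" by (simp add: quenched_law_def)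
  have m: "(\<lambda>w. w p) \<in> quenched_law (a, b) \<rightarrow>\<^sub>M ?D p" for p
    unfolding q by (rule measurable_component_singleton) simp
  then show "(\<lambda>w. w p) \<in> borel_measurable (quenched_law (a, b))" for p
    by (simp add: split_beta)
  show "AE w in quenched_law (a, b). \<forall>p. 0 \<le> w p"
    unfolding AE_all_countable q
  proof
    fix p show "AE w in Pi\<^sub>M UNIV ?D. 0 \<le> w p"
      by (rule AE_PiM_component[OF pr]) (rule UNIV_I, cases p, auto simp: AE_density exponential_density_def)
  qed
  assume h: "h \<in> borel_measurable borel"
  have "(\<integral>\<^sup>+w. h (w (i, j)) \<partial>quenched_law (a, b)) = (\<integral>\<^sup>+x. h x \<partial>distr (quenched_law (a, b)) (?D (i, j)) (\<lambda>w. w (i, j)))"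
    using h by (intro nn_integral_distr[symmetric] m) simp
  also have "distr (quenched_law (a, b)) (?D (i, j)) (\<lambda>w. w (i, j)) = ?D (i, j)"
    unfolding q by (rule distr_PiM_component[OF pr]) simp
  finally show "(\<integral>\<^sup>+w. h (w (i, j)) \<partial>quenched_law (a, b)) = (\<integral>\<^sup>+x. h x \<partial>exp_law (a i + b j))"
    by simp
qed

lemma quenched_lower_bound:
  assumes pos: "\<And>i. 0 < a i" "\<And>j. 0 < b j" and d: "0 < d" and M: "0 < M"
    and small: "a I < d" "b J < d" and ij: "J < N" "N \<le> n" "m' \<le> I" "I < m"
  shows "(\<Sum>i<m'. ennreal (1 / (a i + d))) + (\<Sum>j\<in>{N..<n}. ennreal (1 / (b j + d))) \<le>
    (\<integral>\<^sup>+w. ennreal (min (G w m n) (M * real (m + n))) \<partial>quenched_law (a, b)) +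
    of_nat (m + n) * ennreal (1 / (2 * M * d\<^sup>2))"
proof -
  let ?q = "quenched_law (a, b)" and ?e = "ennreal (1 / (2 * M * d\<^sup>2))"
  note [measurable] = measurable_quenched_coord[OF pos]
  have row: "ennreal (1 / (a i + d)) \<le> (\<integral>\<^sup>+w. ennreal (min (w (i, J)) M) \<partial>?q) + ?e" for i
    using pos(1)[of i] pos(2)[of J] d M small
    by (subst nn_integral_quenched_coord[OF pos]) (auto intro!: nn_integral_exp_law_min_lower)
  have col: "ennreal (1 / (b j + d)) \<le> (\<integral>\<^sup>+w. ennreal (min (w (I, j)) M) \<partial>?q) + ?e" for j
    using pos(1)[of I] pos(2)[of j] d M small
    by (subst nn_integral_quenched_coord[OF pos]) (auto intro!: nn_integral_exp_law_min_lower)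
  have "(\<Sum>i<m'. ennreal (1 / (a i + d))) + (\<Sum>j\<in>{N..<n}. ennreal (1 / (b j + d))) \<le>
     (\<Sum>i<m'. (\<integral>\<^sup>+w. ennreal (min (w (i, J)) M) \<partial>?q) + ?e) + (\<Sum>j\<in>{N..<n}. (\<integral>\<^sup>+w. ennreal (min (w (I, j)) M) \<partial>?q) + ?e)"
    by (intro add_mono sum_mono row col)
  also have "\<dots> = (\<integral>\<^sup>+w. (\<Sum>i<m'. ennreal (min (w (i, J)) M)) + (\<Sum>j\<in>{N..<n}. ennreal (min (w (I, j)) M)) \<partial>?q)
      + (of_nat m' + of_nat (n - N)) * ?e"
    by (subst nn_integral_add) (auto simp: nn_integral_sum sum.distrib distrib_right ac_simps)
  also have "\<dots> \<le> (\<integral>\<^sup>+w. ennreal (min (G w m n) (M * real (m + n))) \<partial>?q) + of_nat (m + n) * ?e"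
  proof (intro add_mono mult_right_mono nn_integral_mono_AE)
    show "AE w in ?q. (\<Sum>i<m'. ennreal (min (w (i, J)) M)) + (\<Sum>j\<in>{N..<n}. ennreal (min (w (I, j)) M))
        \<le> ennreal (min (G w m n) (M * real (m + n)))"
      using AE_quenched_nonneg[OF pos]
    proof eventually_elim
      case (elim w)
      let ?S = "(\<Sum>i<m'. min (w (i, J)) M) + (\<Sum>j\<in>{N..<n}. min (w (I, j)) M)"
      have "?S \<le> (\<Sum>i<m'. w (i, J)) + (\<Sum>j\<in>{N..<n}. w (I, j))"
        by (intro add_mono sum_mono) auto
      also have "\<dots> \<le> G w m n"
        by (rule G_ge_row_then_column[OF elim ij])
      finally have S1: "?S \<le> G w m n" .
      have "?S \<le> (\<Sum>i<m'. M) + (\<Sum>j\<in>{N..<n}. M)"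
        by (intro add_mono sum_mono) auto
      also have "\<dots> = M * real (m' + (n - N))" by (simp add: algebra_simps)
      also have "\<dots> \<le> M * real (m + n)"
        using ij M by (intro mult_left_mono) auto
      finally have "?S \<le> min (G w m n) (M * real (m + n))" using S1 by simp
      moreover have "(\<Sum>i<m'. ennreal (min (w (i, J)) M)) + (\<Sum>j\<in>{N..<n}. ennreal (min (w (I, j)) M)) = ennreal ?S"
        using elim M by (subst ennreal_plus) (auto intro!: sum_nonneg)
      ultimately show ?case by (simp add: ennreal_leI)
    qed
    show "of_nat m' + of_nat (n - N) \<le> (of_nat (m + n) :: ennreal)"
      unfolding of_nat_add[symmetric] using ij by (intro of_nat_mono) auto
  qed auto
  finally show ?thesis .
qed

context ergodic_environment
begin

text \<open>
  The conclusion of \<open>quenched_lower_bound\<close> does not mention \<open>I\<close> and \<open>J\<close>, so it can be integrated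
  over all environments for which such indices exist. On the remaining ones its left-hand side is at
  most \<open>(m + n) / d\<close>. The window for \<open>I\<close> is at the far end of the columns, and stationarity
  moves it to the origin.
\<close>

lemma annealed_lower_bound:
  assumes d: "0 < d" and M: "0 < M" and N: "N \<le> m" "N \<le> n"
  shows "of_nat (m - N) * (\<integral>\<^sup>+\<omega>. ennreal (1 / (fst \<omega> 0 + d)) \<partial>\<mu>) + of_nat (n - N) * (\<integral>\<^sup>+\<omega>. ennreal (1 / (snd \<omega> 0 + d)) \<partial>\<mu>)
    \<le> (\<integral>\<^sup>+w. ennreal (min (G w m n) (M * real (m + n))) \<partial>annealed_law \<mu>) +
      of_nat (m + n) * (ennreal (1 / (2 * M * d\<^sup>2)) + ennreal (1 / d) *
        (emeasure \<mu> {\<omega> \<in> space \<mu>. \<forall>i<N. d \<le> fst \<omega> i} + emeasure \<mu> {\<omega> \<in> space \<mu>. \<forall>j<N. d \<le> snd \<omega> j}))"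
proof -
  let ?e = "ennreal (1 / (2 * M * d\<^sup>2))"
  define A where "A = {\<omega> \<in> space \<mu>. \<forall>i<N. d \<le> fst \<omega> i}"
  define A' where "A' = {\<omega> \<in> space \<mu>. \<forall>i<N. d \<le> fst \<omega> (i + (m - N))}"
  define B where "B = {\<omega> \<in> space \<mu>. \<forall>j<N. d \<le> snd \<omega> j}"
  have [measurable]: "A \<in> sets \<mu>" "A' \<in> sets \<mu>" "B \<in> sets \<mu>"
    unfolding A_def A'_def B_def by measurable
  have "A' = {\<omega> \<in> space \<mu>. diag_shift (m - N) \<omega> \<in> A}"
    using measurable_space[OF diag_shift_measurable] by (auto simp: A_def A'_def)
  then have A': "emeasure \<mu> A' = emeasure \<mu> A"
    using emeasure_diag_shift[of A "m - N"] by simp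
  define F where "F \<omega> = (\<integral>\<^sup>+w. ennreal (min (G w m n) (M * real (m + n))) \<partial>quenched_law \<omega>)" for \<omega>
  have [measurable]: "F \<in> borel_measurable \<mu>"
    unfolding F_def
    by (rule measurable_compose[OF measurable_quenched nn_integral_measurable_subprob_algebra]) measurable
  let ?S = "\<lambda>\<omega>. (\<Sum>i<m - N. ennreal (1 / (fst \<omega> i + d))) + (\<Sum>j\<in>{N..<n}. ennreal (1 / (snd \<omega> j + d)))"
  have pw: "?S \<omega> \<le> F \<omega> + of_nat (m + n) * (?e + ennreal (1 / d) * (indicator A' \<omega> + indicator B \<omega>))"
    if \<omega>: "\<omega> \<in> space \<mu>" for \<omega>
  proof (cases "\<omega> \<in> A' \<union> B")
    case True
    have "ennreal (1 / (fst \<omega> i + d)) \<le> ennreal (1 / d)" "ennreal (1 / (snd \<omega> i + d)) \<le> ennreal (1 / d)" for i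
      using env_pos[OF \<omega>, of i] d by (auto intro!: ennreal_leI divide_left_mono mult_pos_pos add_pos_pos)
    then have "?S \<omega> \<le> (\<Sum>i<m - N. ennreal (1 / d)) + (\<Sum>j\<in>{N..<n}. ennreal (1 / d))"
      by (intro add_mono sum_mono) auto
    also have "\<dots> = of_nat (m - N + (n - N)) * ennreal (1 / d)"
      by (simp add: distrib_right)
    also have "\<dots> \<le> of_nat (m + n) * ennreal (1 / d)"
      by (intro mult_right_mono of_nat_mono) auto
    also have "\<dots> \<le> of_nat (m + n) * (?e + ennreal (1 / d) * (indicator A' \<omega> + indicator B \<omega>))"
    proof (intro mult_left_mono)
      have "(1::ennreal) \<le> indicator A' \<omega> + indicator B \<omega>"
        using True by (auto simp: indicator_def)
      then have "ennreal (1 / d) * 1 \<le> ennreal (1 / d) * (indicator A' \<omega> + indicator B \<omega>)"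
        by (rule mult_left_mono) simp
      then show "ennreal (1 / d) \<le> ?e + ennreal (1 / d) * (indicator A' \<omega> + indicator B \<omega>)"
        by (simp add: add_increasing)
    qed simp
    finally show ?thesis by (simp add: add_increasing)
  next
    case False
    then obtain i J where i: "i < N" "fst \<omega> (i + (m - N)) < d" and J: "J < N" "snd \<omega> J < d"
      using \<omega> by (auto simp: A'_def B_def not_le)
    have "?S \<omega> \<le> F \<omega> + of_nat (m + n) * ?e"
      using quenched_lower_bound[of "fst \<omega>" "snd \<omega>" d M "i + (m - N)" J N n "m - N" m] env_pos[OF \<omega>] d M i J N
      by (simp add: F_def)
    also have "\<dots> \<le> F \<omega> + of_nat (m + n) * (?e + ennreal (1 / d) * (indicator A' \<omega> + indicator B \<omega>))"
      by (intro add_left_mono mult_left_mono) auto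
    finally show ?thesis .
  qed
  have "of_nat (m - N) * (\<integral>\<^sup>+\<omega>. ennreal (1 / (fst \<omega> 0 + d)) \<partial>\<mu>) + of_nat (n - N) * (\<integral>\<^sup>+\<omega>. ennreal (1 / (snd \<omega> 0 + d)) \<partial>\<mu>)
    = (\<Sum>i<m - N. \<integral>\<^sup>+\<omega>. ennreal (1 / (fst \<omega> 0 + d)) \<partial>\<mu>) + (\<Sum>j\<in>{N..<n}. \<integral>\<^sup>+\<omega>. ennreal (1 / (snd \<omega> 0 + d)) \<partial>\<mu>)"
    by simp
  also have "\<dots> = (\<Sum>i<m - N. \<integral>\<^sup>+\<omega>. ennreal (1 / (fst \<omega> i + d)) \<partial>\<mu>) + (\<Sum>j\<in>{N..<n}. \<integral>\<^sup>+\<omega>. ennreal (1 / (snd \<omega> j + d)) \<partial>\<mu>)"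
    by (intro arg_cong2[where f="(+)"] sum.cong refl nn_integral_env_coord[where h="\<lambda>x. ennreal (1 / (x + d))", symmetric]) measurable
  also have "\<dots> = (\<integral>\<^sup>+\<omega>. ?S \<omega> \<partial>\<mu>)"
    by (subst nn_integral_add) (auto simp: nn_integral_sum)
  also have "\<dots> \<le> (\<integral>\<^sup>+\<omega>. F \<omega> + of_nat (m + n) * (?e + ennreal (1 / d) * (indicator A' \<omega> + indicator B \<omega>)) \<partial>\<mu>)"
    using pw by (rule nn_integral_mono)
  also have "\<dots> = (\<integral>\<^sup>+\<omega>. F \<omega> \<partial>\<mu>) + of_nat (m + n) * (?e + ennreal (1 / d) * (emeasure \<mu> A' + emeasure \<mu> B))"
    by (simp add: nn_integral_add nn_integral_cmult emeasure_space_1)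
  also have "(\<integral>\<^sup>+\<omega>. F \<omega> \<partial>\<mu>) = (\<integral>\<^sup>+w. ennreal (min (G w m n) (M * real (m + n))) \<partial>annealed_law \<mu>)"
    unfolding F_def by (rule nn_integral_annealed[symmetric]) measurable
  finally show ?thesis unfolding A' by (simp add: A_def B_def)
qed

end

section \<open>Limits of the two bounds\<close>

context ergodic_environment
begin

lemma nn_integral_inverse_regularized:
  fixes X :: "(nat \<Rightarrow> real) \<times> (nat \<Rightarrow> real) \<Rightarrow> real"
  assumes [measurable]: "X \<in> borel_measurable \<mu>" and pos: "\<And>\<omega>. \<omega> \<in> space \<mu> \<Longrightarrow> 0 < X \<omega>"
  shows "(\<lambda>r. \<integral>\<^sup>+\<omega>. ennreal (1 / (X \<omega> + 1 / real (Suc r))) \<partial>\<mu>) \<longlonglongrightarrow> (\<integral>\<^sup>+\<omega>. ennreal (1 / X \<omega>) \<partial>\<mu>)"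
proof -
  define f where "f r \<omega> = ennreal (1 / (X \<omega> + 1 / real (Suc r))) * indicator (space \<mu>) \<omega>" for r \<omega>
  define u where "u \<omega> = ennreal (1 / X \<omega>) * indicator (space \<mu>) \<omega>" for \<omega>
  have "(\<lambda>r. \<integral>\<^sup>+\<omega>. f r \<omega> \<partial>\<mu>) \<longlonglongrightarrow> (\<integral>\<^sup>+\<omega>. u \<omega> \<partial>\<mu>)"
  proof (rule nn_integral_LIMSEQ)
    show "incseq f"
    proof (rule incseq_SucI, rule le_funI)
      fix r \<omega>
      show "f r \<omega> \<le> f (Suc r) \<omega>"
      proof (cases "\<omega> \<in> space \<mu>")
        case True
        have "1 / (X \<omega> + 1 / real (Suc r)) \<le> 1 / (X \<omega> + 1 / real (Suc (Suc r)))"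
          using pos[OF True]
          by (intro divide_left_mono add_left_mono mult_pos_pos add_pos_pos) auto
        then show ?thesis by (simp add: f_def ennreal_leI True)
      qed (simp add: f_def)
    qed
    show "f r \<in> borel_measurable \<mu>" for r unfolding f_def by measurable
    show "(\<lambda>r. f r \<omega>) \<longlonglongrightarrow> u \<omega>" for \<omega>
    proof (cases "\<omega> \<in> space \<mu>")
      case True
      have "(\<lambda>r. 1 / (X \<omega> + 1 / real (Suc r))) \<longlonglongrightarrow> 1 / (X \<omega> + 0)"
        using pos[OF True] LIMSEQ_inverse_real_of_nat
        by (intro tendsto_intros) (auto simp: inverse_eq_divide)
      then show ?thesis using True by (simp add: f_def u_def tendsto_ennrealI)
    qed (simp add: f_def u_def)
  qed
  moreover have "(\<integral>\<^sup>+\<omega>. f r \<omega> \<partial>\<mu>) = (\<integral>\<^sup>+\<omega>. ennreal (1 / (X \<omega> + 1 / real (Suc r))) \<partial>\<mu>)" for r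
    unfolding f_def by (rule nn_integral_cong) auto
  moreover have "(\<integral>\<^sup>+\<omega>. u \<omega> \<partial>\<mu>) = (\<integral>\<^sup>+\<omega>. ennreal (1 / X \<omega>) \<partial>\<mu>)"
    unfolding u_def by (rule nn_integral_cong) auto
  ultimately show ?thesis by simp
qed

lemma shape_upper_bound:
  assumes st: "0 \<le> s" "0 \<le> t"
    and conv: "AE w in annealed_law \<mu>.
      (\<lambda>k. ennreal (G w (nat \<lfloor>real k * s\<rfloor>) (nat \<lfloor>real k * t\<rfloor>) / real k)) \<longlonglongrightarrow> \<gamma>"
  shows "\<gamma> \<le> ennreal s * (\<integral>\<^sup>+\<omega>. ennreal (1 / fst \<omega> 0) \<partial>\<mu>) + ennreal t * (\<integral>\<^sup>+\<omega>. ennreal (1 / snd \<omega> 0) \<partial>\<mu>)"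
    (is "_ \<le> ennreal s * ?A + ennreal t * ?B")
proof -
  interpret P: prob_space "annealed_law \<mu>" by (rule prob_space_annealed)
  let ?G = "\<lambda>k w. G w (nat \<lfloor>real k * s\<rfloor>) (nat \<lfloor>real k * t\<rfloor>)"
  have bound: "(\<integral>\<^sup>+w. ennreal (?G k w / real k) \<partial>annealed_law \<mu>) \<le> ennreal s * ?A + ennreal t * ?B" if k: "1 \<le> k" for k
  proof -
    have fl: "ennreal (1 / real k) * of_nat (nat \<lfloor>real k * x\<rfloor>) \<le> ennreal x" if "0 \<le> x" for x
    proof -
      have "real (nat \<lfloor>real k * x\<rfloor>) \<le> real k * x" using that by simp
      then have "1 / real k * real (nat \<lfloor>real k * x\<rfloor>) \<le> x"
        using k by (simp add: divide_le_eq mult.commute)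
      then have "ennreal (1 / real k * real (nat \<lfloor>real k * x\<rfloor>)) \<le> ennreal x" by (rule ennreal_leI)
      then show ?thesis
        unfolding ennreal_of_nat_eq_real_of_nat by (subst ennreal_mult'[symmetric]) auto
    qed
    have "(\<integral>\<^sup>+w. ennreal (?G k w / real k) \<partial>annealed_law \<mu>) = (\<integral>\<^sup>+w. ennreal (1 / real k) * ennreal (?G k w) \<partial>annealed_law \<mu>)"
      by (intro nn_integral_cong) (simp add: ennreal_mult'[symmetric])
    also have "\<dots> = ennreal (1 / real k) * (\<integral>\<^sup>+w. ennreal (?G k w) \<partial>annealed_law \<mu>)"
      by (rule nn_integral_cmult) measurable
    also have "\<dots> \<le> ennreal (1 / real k) * (of_nat (nat \<lfloor>real k * s\<rfloor>) * ?A + of_nat (nat \<lfloor>real k * t\<rfloor>) * ?B)"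
      by (intro mult_left_mono annealed_upper_bound) simp
    also have "\<dots> = (ennreal (1 / real k) * of_nat (nat \<lfloor>real k * s\<rfloor>)) * ?A + (ennreal (1 / real k) * of_nat (nat \<lfloor>real k * t\<rfloor>)) * ?B"
      by (simp add: distrib_left mult.assoc)
    also have "\<dots> \<le> ennreal s * ?A + ennreal t * ?B"
      using st by (intro add_mono mult_right_mono fl) auto
    finally show ?thesis .
  qed
  have "\<gamma> = (\<integral>\<^sup>+w. \<gamma> \<partial>annealed_law \<mu>)" by (simp add: P.emeasure_space_1)
  also have "\<dots> = (\<integral>\<^sup>+w. liminf (\<lambda>k. ennreal (?G k w / real k)) \<partial>annealed_law \<mu>)"
    using conv by (intro nn_integral_cong_AE) (auto elim!: eventually_mono dest: lim_imp_Liminf[OF sequentially_bot])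
  also have "\<dots> \<le> liminf (\<lambda>k. \<integral>\<^sup>+w. ennreal (?G k w / real k) \<partial>annealed_law \<mu>)"
    by (rule nn_integral_liminf) measurable
  also have "\<dots> \<le> limsup (\<lambda>k. \<integral>\<^sup>+w. ennreal (?G k w / real k) \<partial>annealed_law \<mu>)"
    by (rule Liminf_le_Limsup) simp
  also have "\<dots> \<le> ennreal s * ?A + ennreal t * ?B"
    using bound by (intro Limsup_bounded eventually_sequentiallyI[of 1])
  finally show ?thesis .
qed

text \<open>
  The truncation level \<open>M\<close> and the window length \<open>N\<close> stay fixed while the scale \<open>k\<close> tends to infinity.
  The truncated passage time divided by \<open>k\<close> is at most \<open>C = M * (s + t)\<close>, so the expectations of
  \<open>G/k\<close> cut off at \<open>C\<close> converge to \<open>min \<gamma> C\<close>.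
\<close>

lemma shape_lower_bound_regularized:
  assumes st: "0 < s" "0 < t"
    and conv: "AE w in annealed_law \<mu>.
      (\<lambda>k. ennreal (G w (nat \<lfloor>real k * s\<rfloor>) (nat \<lfloor>real k * t\<rfloor>) / real k)) \<longlonglongrightarrow> \<gamma>"
    and d: "0 < d"
    and ends: "emeasure \<mu> {\<omega> \<in> space \<mu>. fst \<omega> 0 < d} > 0" "emeasure \<mu> {\<omega> \<in> space \<mu>. snd \<omega> 0 < d} > 0"
  shows "ennreal s * (\<integral>\<^sup>+\<omega>. ennreal (1 / (fst \<omega> 0 + d)) \<partial>\<mu>) + ennreal t * (\<integral>\<^sup>+\<omega>. ennreal (1 / (snd \<omega> 0 + d)) \<partial>\<mu>) \<le> \<gamma>"
    (is "ennreal s * ?A + ennreal t * ?B \<le> _")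
proof (rule ennreal_le_epsilon)
  fix e :: real assume e: "0 < e"
  interpret P: prob_space "annealed_law \<mu>" by (rule prob_space_annealed)
  define \<kappa> where "\<kappa> = e / (s + t)"
  \<comment> \<open>This level makes the truncation error \<open>1 / (2 * M * d\<^sup>2)\<close> per weight equal to \<open>\<kappa> / 2\<close>.\<close>
  define M where "M = 1 / (\<kappa> * d\<^sup>2)"
  define C where "C = M * (s + t)"
  have \<kappa>: "0 < \<kappa>" and M: "0 < M" and C: "0 < C" using e st d by (auto simp: \<kappa>_def M_def C_def)
  let ?m = "\<lambda>k. nat \<lfloor>real k * s\<rfloor>" and ?n = "\<lambda>k. nat \<lfloor>real k * t\<rfloor>"
  let ?bad = "\<lambda>N. emeasure \<mu> {\<omega> \<in> space \<mu>. \<forall>i<N. d \<le> fst \<omega> i} + emeasure \<mu> {\<omega> \<in> space \<mu>. \<forall>j<N. d \<le> snd \<omega> j}"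
  have "(\<lambda>N. ennreal (1 / d) * ?bad N) \<longlonglongrightarrow> ennreal (1 / d) * (0 + 0)"
    using avoid_window_tendsto_0[of "\<lambda>\<omega>. fst \<omega> 0" d] avoid_window_tendsto_0[of "\<lambda>\<omega>. snd \<omega> 0" d] ends
    by (intro ennreal_tendsto_cmult tendsto_add) auto
  then have "eventually (\<lambda>N. ennreal (1 / d) * ?bad N < ennreal (\<kappa> / 2)) sequentially"
    using \<kappa> by (intro order_tendstoD(2)) auto
  then obtain N where N: "ennreal (1 / d) * ?bad N < ennreal (\<kappa> / 2)"
    by (auto simp: eventually_sequentially)
  have err: "ennreal (1 / (2 * M * d\<^sup>2)) + ennreal (1 / d) * ?bad N \<le> ennreal \<kappa>"
  proof -
    have "1 / (2 * M * d\<^sup>2) = \<kappa> / 2" using d \<kappa> by (simp add: M_def)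
    then have "ennreal (1 / (2 * M * d\<^sup>2)) = ennreal (\<kappa> / 2)" by (rule arg_cong)
    then have "ennreal (1 / (2 * M * d\<^sup>2)) + ennreal (1 / d) * ?bad N \<le> ennreal (\<kappa> / 2) + ennreal (\<kappa> / 2)"
      using less_imp_le[OF N] by (intro add_mono) (rule eq_refl)
    also have "\<dots> = ennreal (\<kappa> / 2 + \<kappa> / 2)" using \<kappa> by (subst ennreal_plus) auto
    finally show ?thesis by simp
  qed
  define U where "U k = (\<integral>\<^sup>+w. min (ennreal (G w (?m k) (?n k) / real k)) (ennreal C) \<partial>annealed_law \<mu>)" for k
  have U: "U \<longlonglongrightarrow> min \<gamma> (ennreal C)"
  proof -
    have "U \<longlonglongrightarrow> (\<integral>\<^sup>+w. min \<gamma> (ennreal C) \<partial>annealed_law \<mu>)"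
      unfolding U_def
    proof (rule nn_integral_dominated_convergence[where w="\<lambda>_. ennreal C"])
      show "AE w in annealed_law \<mu>. (\<lambda>k. min (ennreal (G w (?m k) (?n k) / real k)) (ennreal C)) \<longlonglongrightarrow> min \<gamma> (ennreal C)"
        using conv by eventually_elim (intro tendsto_min tendsto_const)
    qed (auto simp: P.emeasure_space_1)
    then show ?thesis by (simp add: P.emeasure_space_1)
  qed
  \<comment> \<open>Finiteness lets the error term \<open>(N + 1) / k\<close> times \<open>?A + ?B\<close> vanish in the limit.\<close>
  have AB: "?A + ?B < \<top>"
  proof -
    have "1 / (fst \<omega> 0 + d) \<le> 1 / d" "1 / (snd \<omega> 0 + d) \<le> 1 / d" if "\<omega> \<in> space \<mu>" for \<omega>
      using env_pos[OF that, of 0] d by (auto intro!: divide_left_mono mult_pos_pos add_pos_pos)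
    then have "?A \<le> (\<integral>\<^sup>+\<omega>. ennreal (1 / d) \<partial>\<mu>)" "?B \<le> (\<integral>\<^sup>+\<omega>. ennreal (1 / d) \<partial>\<mu>)"
      by (intro nn_integral_mono ennreal_leI; blast)+
    then have "?A \<le> ennreal (1 / d)" "?B \<le> ennreal (1 / d)"
      by (simp_all add: emeasure_space_1)
    then have "?A < \<top>" "?B < \<top>"
      using ennreal_less_top le_less_trans by blast+
    then show ?thesis by simp
  qed
  have main: "ennreal s * ?A + ennreal t * ?B \<le> U k + ennreal e + (?A + ?B) * ennreal (real (N + 1) / real k)"
    if k: "1 \<le> k" "N \<le> ?m k" "N \<le> ?n k" for k
  proof -
    let ?k = "ennreal (real k)"
    \<comment> \<open>Rounding down loses at most 1 and the window loses \<open>N\<close>.\<close>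
    have fl: "?k * ennreal x \<le> of_nat (nat \<lfloor>real k * x\<rfloor> - N) + ennreal (real (N + 1))" if "0 < x" "N \<le> nat \<lfloor>real k * x\<rfloor>" for x
    proof -
      have "real k * x \<le> real (nat \<lfloor>real k * x\<rfloor> - N) + real (N + 1)"
        using that(2) by (simp add: of_nat_diff) linarith
      then have "ennreal (real k * x) \<le> ennreal (real (nat \<lfloor>real k * x\<rfloor> - N) + real (N + 1))"
        by (rule ennreal_leI)
      then show ?thesis
        using that(1) by (simp add: ennreal_mult ennreal_of_nat_eq_real_of_nat del: of_nat_add of_nat_Suc)
    qed
    have mn: "real (?m k + ?n k) \<le> real k * (s + t)"
    proof -
      have "real (?m k) \<le> real k * s" "real (?n k) \<le> real k * t" using st by auto
      then show ?thesis by (simp add: distrib_left)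
    qed
    have pt: "ennreal (min (G w (?m k) (?n k)) (M * real (?m k + ?n k))) \<le> ?k * min (ennreal (G w (?m k) (?n k) / real k)) (ennreal C)" for w
    proof -
      have "M * real (?m k + ?n k) \<le> M * (real k * (s + t))"
        using M mn by (intro mult_left_mono) auto
      also have "\<dots> = real k * C" by (simp add: C_def)
      finally have *: "M * real (?m k + ?n k) \<le> real k * C" .
      have "min (G w (?m k) (?n k)) (M * real (?m k + ?n k)) \<le> real k * (G w (?m k) (?n k) / real k)"
        using k by simp
      then have 1: "ennreal (min (G w (?m k) (?n k)) (M * real (?m k + ?n k))) \<le> ?k * ennreal (G w (?m k) (?n k) / real k)"
        using ennreal_leI by (subst ennreal_mult'[symmetric]) auto
      have "min (G w (?m k) (?n k)) (M * real (?m k + ?n k)) \<le> real k * C"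
        using * by simp
      then have 2: "ennreal (min (G w (?m k) (?n k)) (M * real (?m k + ?n k))) \<le> ?k * ennreal C"
        using ennreal_leI by (subst ennreal_mult'[symmetric]) auto
      from 1 2 show ?thesis by (auto simp: min_def)
    qed
    have "?k * (ennreal s * ?A + ennreal t * ?B) = (?k * ennreal s) * ?A + (?k * ennreal t) * ?B"
      by (simp add: distrib_left mult.assoc)
    also have "\<dots> \<le> (of_nat (?m k - N) + ennreal (real (N + 1))) * ?A + (of_nat (?n k - N) + ennreal (real (N + 1))) * ?B"
      using st k by (intro add_mono mult_right_mono fl) auto
    also have "\<dots> = (of_nat (?m k - N) * ?A + of_nat (?n k - N) * ?B) + ennreal (real (N + 1)) * (?A + ?B)"
      by (simp only: distrib_left distrib_right ac_simps)
    also have "of_nat (?m k - N) * ?A + of_nat (?n k - N) * ?B \<le>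
        (\<integral>\<^sup>+w. ennreal (min (G w (?m k) (?n k)) (M * real (?m k + ?n k))) \<partial>annealed_law \<mu>)
        + of_nat (?m k + ?n k) * (ennreal (1 / (2 * M * d\<^sup>2)) + ennreal (1 / d) * ?bad N)"
      by (rule annealed_lower_bound[OF d M k(2,3)])
    also have "\<dots> \<le> ?k * U k + ?k * ennreal e"
    proof (rule add_mono)
      have "(\<integral>\<^sup>+w. ennreal (min (G w (?m k) (?n k)) (M * real (?m k + ?n k))) \<partial>annealed_law \<mu>) \<le>
          (\<integral>\<^sup>+w. ?k * min (ennreal (G w (?m k) (?n k) / real k)) (ennreal C) \<partial>annealed_law \<mu>)"
        by (intro nn_integral_mono pt)
      also have "\<dots> = ?k * U k"
        unfolding U_def by (rule nn_integral_cmult) measurable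
      finally show "(\<integral>\<^sup>+w. ennreal (min (G w (?m k) (?n k)) (M * real (?m k + ?n k))) \<partial>annealed_law \<mu>) \<le> ?k * U k" .
      have "of_nat (?m k + ?n k) * (ennreal (1 / (2 * M * d\<^sup>2)) + ennreal (1 / d) * ?bad N) \<le> ennreal (real k * (s + t)) * ennreal \<kappa>"
      proof (rule mult_mono[OF _ err])
        show "of_nat (?m k + ?n k) \<le> ennreal (real k * (s + t))"
          using ennreal_leI[OF mn] by (simp only: ennreal_of_nat_eq_real_of_nat)
      qed auto
      also have "\<dots> = ennreal (real k * e)"
        using st \<kappa> by (subst ennreal_mult[symmetric]) (auto simp: \<kappa>_def)
      also have "\<dots> = ?k * ennreal e" by (rule ennreal_mult') simp
      finally show "of_nat (?m k + ?n k) * (ennreal (1 / (2 * M * d\<^sup>2)) + ennreal (1 / d) * ?bad N) \<le> ?k * ennreal e" .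
    qed
    also have "?k * U k + ?k * ennreal e + ennreal (real (N + 1)) * (?A + ?B) =
      ?k * (U k + ennreal e + (?A + ?B) * ennreal (real (N + 1) / real k))"
    proof -
      have "ennreal (real (N + 1)) = ?k * ennreal (real (N + 1) / real k)"
        using k by (subst ennreal_mult'[symmetric]) auto
      then show ?thesis by (simp only: distrib_left ac_simps)
    qed
    finally have "?k * (ennreal s * ?A + ennreal t * ?B) \<le> ?k * (U k + ennreal e + (?A + ?B) * ennreal (real (N + 1) / real k))"
      by (simp add: add_right_mono)
    then show ?thesis
      using k by (subst (asm) ennreal_mult_le_mult_iff) auto
  qed
  have "(\<lambda>k. U k + ennreal e + (?A + ?B) * ennreal (real (N + 1) / real k)) \<longlonglongrightarrow> min \<gamma> (ennreal C) + ennreal e + (?A + ?B) * ennreal 0"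
    by (intro tendsto_add U tendsto_const ennreal_tendsto_cmult AB tendsto_ennrealI lim_const_over_n)
  moreover have ev: "eventually (\<lambda>k. N \<le> nat \<lfloor>real k * x\<rfloor>) sequentially" if "0 < x" for x
  proof (rule eventually_sequentiallyI)
    fix k assume "nat \<lceil>real N / x\<rceil> \<le> k"
    then have "real N / x \<le> real k" by linarith
    then have "real N \<le> real k * x" using that by (simp add: divide_le_eq)
    then show "N \<le> nat \<lfloor>real k * x\<rfloor>" by linarith
  qed
  have "eventually (\<lambda>k. ennreal s * ?A + ennreal t * ?B \<le> U k + ennreal e + (?A + ?B) * ennreal (real (N + 1) / real k)) sequentially"
    using ev[OF st(1)] ev[OF st(2)] eventually_ge_at_top[of 1]
    by eventually_elim (rule main)
  ultimately have "ennreal s * ?A + ennreal t * ?B \<le> min \<gamma> (ennreal C) + ennreal e + (?A + ?B) * ennreal 0"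
    by (intro tendsto_lowerbound) auto
  also have "\<dots> \<le> \<gamma> + ennreal e" by (simp add: add_right_mono)
  finally show "ennreal s * ?A + ennreal t * ?B \<le> \<gamma> + ennreal e" .
qed

end

theorem theorem2p2:
  fixes \<mu> :: "((nat \<Rightarrow> real) \<times> (nat \<Rightarrow> real)) measure"
    and g :: "real \<Rightarrow> real \<Rightarrow> ennreal"
  assumes "environment \<mu>"
    and "left_endpoint (law_a \<mu>) = 0" and "left_endpoint (law_b \<mu>) = 0"
    and "is_shape_function \<mu> g"
  shows "\<forall>s>0. \<forall>t>0. g s t =
           ennreal s * (\<integral>\<^sup>+(a, b). ennreal (1 / a 0) \<partial>\<mu>) +
           ennreal t * (\<integral>\<^sup>+(a, b). ennreal (1 / b 0) \<partial>\<mu>)"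
proof (intro allI impI)
  fix s t :: real assume st: "0 < s" "0 < t"
  interpret ergodic_environment \<mu> by standard (rule assms(1))
  let ?A = "\<integral>\<^sup>+\<omega>. ennreal (1 / fst \<omega> 0) \<partial>\<mu>" and ?B = "\<integral>\<^sup>+\<omega>. ennreal (1 / snd \<omega> 0) \<partial>\<mu>"
  have conv: "AE w in annealed_law \<mu>.
      (\<lambda>k. ennreal (G w (nat \<lfloor>real k * s\<rfloor>) (nat \<lfloor>real k * t\<rfloor>) / real k)) \<longlonglongrightarrow> g s t"
    using assms(4) unfolding is_shape_function_def
  proof eventually_elim
    case (elim w)
    then have "(\<lambda>k. ereal (G w (nat \<lfloor>real k * s\<rfloor>) (nat \<lfloor>real k * t\<rfloor>) / real k)) \<longlonglongrightarrow> enn2ereal (g s t)"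
      using st by blast
    from tendsto_e2ennrealI[OF this] show ?case by simp
  qed
  have upper: "g s t \<le> ennreal s * ?A + ennreal t * ?B"
    using st by (intro shape_upper_bound conv) auto
  have "law_a \<mu> = distr \<mu> borel (\<lambda>\<omega>. fst \<omega> 0)" "law_b \<mu> = distr \<mu> borel (\<lambda>\<omega>. snd \<omega> 0)"
    by (simp_all add: law_a_def law_b_def case_prod_beta')
  then have ends: "emeasure \<mu> {\<omega> \<in> space \<mu>. fst \<omega> 0 < d} > 0" "emeasure \<mu> {\<omega> \<in> space \<mu>. snd \<omega> 0 < d} > 0"
    if "0 < d" for d
    using assms(2,3) that by (auto intro!: left_endpoint_less)
  have "(\<lambda>r. ennreal s * (\<integral>\<^sup>+\<omega>. ennreal (1 / (fst \<omega> 0 + 1 / real (Suc r))) \<partial>\<mu>) +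
      ennreal t * (\<integral>\<^sup>+\<omega>. ennreal (1 / (snd \<omega> 0 + 1 / real (Suc r))) \<partial>\<mu>)) \<longlonglongrightarrow> ennreal s * ?A + ennreal t * ?B"
    using env_pos by (intro tendsto_add ennreal_tendsto_cmult nn_integral_inverse_regularized) auto
  then have lower: "ennreal s * ?A + ennreal t * ?B \<le> g s t"
    using ends by (intro LIMSEQ_le_const2) (auto intro!: exI[of _ 0] shape_lower_bound_regularized[OF st conv])
  from upper lower show "g s t = ennreal s * (\<integral>\<^sup>+(a, b). ennreal (1 / a 0) \<partial>\<mu>) + ennreal t * (\<integral>\<^sup>+(a, b). ennreal (1 / b 0) \<partial>\<mu>)"
    by (simp add: case_prod_beta' antisym)
qed

end
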